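(* There is an absolute constant $C>0$ such that for every integer $d\geq 2$ there exists $N_0(d)$ with the following property. Let $F\in\mathbb{R}[x,y]$ be an irreducible polynomial of degree $d$. Then for every integer $N\geq N_0(d)$, $$\left\lvert \{(x,y)\in\{1,\ldots,N\}^2 : F(x,y)=0\}\right\rvert \leq (\log N)^{Cd}\,N^{1/d}.$$
   Context: A polynomial $F\in\mathbb{R}[x,y]$ is irreducible if it is non-constant and cannot be factored as a product of two non-constant polynomials in $\mathbb{R}[x,y]$. The constant $C$ is independent of $d$, $F$ and $N$; the threshold $N_0(d)$ depends only on $d$, not on the coefficients of $F$. *)

theory Defs
  imports Complex_Main "HOL-Computational_Algebra.Computational_Algebra"
begin

text \<open>
  A polynomial in \<open>\<real>[x,y]\<close> is rendered as an element \<open>F\<close> of \<open>\<real>[y][x]\<close>: the coefficient of the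
  monomial \<open>x^i y^j\<close> is \<open>coeff (coeff F i) j\<close>.
\<close>

definition poly_xy :: "'a::comm_semiring_1 poly poly \<Rightarrow> 'a \<Rightarrow> 'a \<Rightarrow> 'a" where
  "poly_xy F x y = poly (poly F [:x:]) y"

text \<open>The \<open>insert 0\<close> only matters for \<open>F = 0\<close>, which gets total degree \<open>0\<close>.\<close>

definition total_degree :: "'a::zero poly poly \<Rightarrow> nat" where
  "total_degree F = Max (insert 0 {i + j |i j. coeff (coeff F i) j \<noteq> 0})"

lemma poly_xy_altdef:
  "poly_xy F x y =
     (\<Sum>i\<le>degree F. \<Sum>j\<le>degree (coeff F i). coeff (coeff F i) j * x ^ i * y ^ j)"
proof -
  have "poly ([:x:] ^ i) y = x ^ i" for i
    by (simp add: poly_power)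
  hence "poly_xy F x y = (\<Sum>i\<le>degree F. poly (coeff F i) y * x ^ i)"
    by (simp add: poly_xy_def poly_altdef[of F] poly_sum)
  also have "\<dots> = (\<Sum>i\<le>degree F. \<Sum>j\<le>degree (coeff F i). coeff (coeff F i) j * x ^ i * y ^ j)"
    by (simp add: poly_altdef[of "coeff F _"] sum_distrib_left sum_distrib_right mult_ac)
  finally show ?thesis .
qed

lemma finite_total_degree_set:
  "finite {i + j |i j. coeff (coeff F i) j \<noteq> 0}"
proof (rule finite_subset)
  show "{i + j |i j. coeff (coeff F i) j \<noteq> 0}
      \<subseteq> (\<lambda>(i, j). i + j) ` (SIGMA i:{..degree F}. {..degree (coeff F i)})"
  proof safe
    fix i j assume nz: "coeff (coeff F i) j \<noteq> 0"
    hence "i \<le> degree F" by (intro le_degree) auto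
    moreover from nz have "j \<le> degree (coeff F i)" by (rule le_degree)
    ultimately show "i + j \<in> (\<lambda>(i, j). i + j) ` (SIGMA i:{..degree F}. {..degree (coeff F i)})"
      by (intro image_eqI[of _ _ "(i, j)"]) auto
  qed
qed auto

lemma le_total_degree:
  "coeff (coeff F i) j \<noteq> 0 \<Longrightarrow> i + j \<le> total_degree F"
  unfolding total_degree_def by (intro Max_ge) (auto simp: finite_total_degree_set)

lemma total_degree_eq_0_iff: "total_degree F = 0 \<longleftrightarrow> (\<exists>c. F = [:[:c:]:])"
proof
  assume deg: "total_degree F = 0"
  have "F = [:[:coeff (coeff F 0) 0:]:]"
  proof (intro poly_eqI)
    fix i j
    show "coeff (coeff F i) j = coeff (coeff [:[:coeff (coeff F 0) 0:]:] i) j"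
      using le_total_degree[of F i j] deg by (cases i; cases j) auto
  qed
  thus "\<exists>c. F = [:[:c:]:]" ..
next
  assume "\<exists>c. F = [:[:c:]:]"
  then obtain c where F: "F = [:[:c:]:]" ..
  have "{i + j |i j. coeff (coeff F i) j \<noteq> 0} \<subseteq> {0}"
  proof
    fix n assume "n \<in> {i + j |i j. coeff (coeff F i) j \<noteq> 0}"
    then obtain i j where "n = i + j" "coeff (coeff F i) j \<noteq> 0" by blast
    thus "n \<in> {0}" by (cases i; cases j) (auto simp: F)
  qed
  hence "insert 0 {i + j |i j. coeff (coeff F i) j \<noteq> 0} = {0}" by blast
  thus "total_degree F = 0" unfolding total_degree_def by (simp only: Max_singleton)
qed

text \<open>
  Over a field, irreducibility in the ring of bivariate polynomials says exactly that the
  polynomial is non-constant and not a product of two non-constant polynomials.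
\<close>

lemma irreducible_bivariate_iff:
  fixes F :: "'a::field poly poly"
  shows "irreducible F \<longleftrightarrow>
    total_degree F \<noteq> 0 \<and> (\<forall>G H. F = G * H \<longrightarrow> total_degree G = 0 \<or> total_degree H = 0)"
proof -
  have unit: "G dvd 1 \<longleftrightarrow> total_degree G = 0 \<and> G \<noteq> 0" for G :: "'a poly poly"
    by (auto simp: total_degree_eq_0_iff is_unit_poly_iff dvd_field_iff)
  have zero: "total_degree (0 :: 'a poly poly) = 0"
    by (auto simp: total_degree_eq_0_iff intro!: exI[of _ 0])
  show ?thesis
    unfolding irreducible_def unit using zero by (metis mult_zero_left mult_zero_right)
qed

end

theory Submission
  imports
    Defs
    "HOL-Computational_Algebra.Field_as_Ring"
    "HOL-Number_Theory.Cong"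
    "HOL-Real_Asymp.Real_Asymp"
begin

text \<open>
  The determinant method modulo primes, with the pigeonhole principle in place of determinants.
  A shear makes \<open>F\<close> monic in \<open>x\<close> up to a constant, and one may assume that \<open>F\<close> has integer
  coefficients of size \<open>N^O(1)\<close>: a small integral polynomial of degree \<open>d\<close> through all the points
  is either a multiple of \<open>F\<close> or meets \<open>F\<close> in boundedly many points. Let \<open>p\<close> be a prime slightly
  larger than \<open>N^(1/d) log N\<close>. On a residue class modulo \<open>p\<close> where \<open>\<partial>F/\<partial>x\<close> is a unit, Hensel's lemma
  expresses \<open>x\<close> as a polynomial in \<open>y\<close> modulo any power of \<open>p\<close>, and counting combinations of the
  monomials \<open>x^i y^j\<close> with \<open>i < d\<close>, \<open>j < log N\<close> yields a nonzero \<open>G\<close> of \<open>x\<close>-degree below \<open>d\<close> whose values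
  at the integral points of the class are divisible by a power of \<open>p\<close> exceeding their size, hence
  vanish. By Bezout the class contains \<open>O(log N)\<close> points, and there are at most \<open>d p\<close> classes. A
  bounded number of primes suffices, because a point with \<open>\<partial>F/\<partial>x \<noteq> 0\<close> is singular modulo boundedly many
  primes of this size only.
\<close>

section \<open>Bivariate polynomials and shears\<close>

lemma poly_xy_simps [simp]:
  "poly_xy 0 x y = 0"
  "poly_xy (F + G) x y = poly_xy F x y + poly_xy G x y"
  "poly_xy (F * G) x y = poly_xy F x y * poly_xy G x y"
  "poly_xy (smult c F) x y = poly c y * poly_xy F x y"
  "poly_xy [:c:] x y = poly c y"
  "poly_xy (pCons c F) x y = poly c y + x * poly_xy F x y"
  by (simp_all add: poly_xy_def algebra_simps)

lemma poly_xy_1 [simp]: "poly_xy 1 x y = 1"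
  by (simp add: poly_xy_def)

lemma poly_xy_power [simp]: "poly_xy (F ^ n) x y = poly_xy F x y ^ n"
  by (induction n) auto

lemma poly_xy_sum [simp]: "poly_xy (\<Sum>a\<in>A. f a) x y = (\<Sum>a\<in>A. poly_xy (f a) x y)"
  by (induction A rule: infinite_finite_induct) auto

lemma poly_xy_monom [simp]: "poly_xy (monom c i) x y = poly c y * x ^ i"
  by (simp add: poly_xy_def poly_monom poly_power)

lemma eval_inner: "poly (map_poly (\<lambda>c. poly c y) F) x = poly_xy F x y"
  by (induction F) (auto simp: map_poly_pCons)

text \<open>A nonzero polynomial over an infinite integral domain does not vanish identically,
  applied first in \<open>x\<close> and then in \<open>y\<close>. It lets identities between sheared
  polynomials be checked on values.\<close>

lemma poly_xy_eqI:
  fixes F G :: "'a::{idom,ring_char_0} poly poly"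
  assumes "\<And>x y. poly_xy F x y = poly_xy G x y"
  shows "F = G"
proof -
  have "coeff F i = coeff G i" for i
  proof -
    have "poly (coeff F i) y = poly (coeff G i) y" for y
    proof -
      have "map_poly (\<lambda>c. poly c y) F = map_poly (\<lambda>c. poly c y) G"
        by (rule poly_ext) (simp add: eval_inner assms)
      then have "coeff (map_poly (\<lambda>c. poly c y) F) i = coeff (map_poly (\<lambda>c. poly c y) G) i" by simp
      then show ?thesis by (simp add: coeff_map_poly)
    qed
    then show ?thesis by (rule poly_ext)
  qed
  then show ?thesis by (rule poly_eqI)
qed

lemma total_degree_le_iff:
  "total_degree F \<le> k \<longleftrightarrow> (\<forall>i j. coeff (coeff F i) j \<noteq> 0 \<longrightarrow> i + j \<le> k)"
  unfolding total_degree_def using finite_total_degree_set[of F] by (subst Max_le_iff) auto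

lemma total_degree_attained:
  assumes "total_degree F \<noteq> 0"
  obtains i j where "i + j = total_degree F" "coeff (coeff F i) j \<noteq> 0"
proof -
  have "total_degree F \<in> insert 0 {i + j |i j. coeff (coeff F i) j \<noteq> 0}"
    unfolding total_degree_def using finite_total_degree_set[of F] by (intro Max_in) auto
  with assms that show ?thesis by auto
qed

lemma coeff_mult_nonzeroE:
  assumes "coeff (coeff (F * G) i) j \<noteq> 0"
  obtains a b where "a \<le> i" "b \<le> j" "coeff (coeff F a) b \<noteq> 0" "coeff (coeff G (i - a)) (j - b) \<noteq> 0"
proof -
  from assms have "(\<Sum>a\<le>i. \<Sum>b\<le>j. coeff (coeff F a) b * coeff (coeff G (i - a)) (j - b)) \<noteq> 0"
    by (simp add: coeff_mult coeff_sum)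
  then obtain a where a: "a \<le> i" "(\<Sum>b\<le>j. coeff (coeff F a) b * coeff (coeff G (i - a)) (j - b)) \<noteq> 0"
    by (meson sum.not_neutral_contains_not_neutral atMost_iff)
  then obtain b where "b \<le> j" "coeff (coeff F a) b * coeff (coeff G (i - a)) (j - b) \<noteq> 0"
    by (meson sum.not_neutral_contains_not_neutral atMost_iff)
  with a(1) show ?thesis by (intro that[of a b]) auto
qed

lemma total_degree_mult_le: "total_degree (F * G) \<le> total_degree F + total_degree G"
proof (unfold total_degree_le_iff, intro allI impI)
  fix i j assume "coeff (coeff (F * G) i) j \<noteq> 0"
  then obtain a b where ab: "a \<le> i" "b \<le> j" "coeff (coeff F a) b \<noteq> 0"
      "coeff (coeff G (i - a)) (j - b) \<noteq> 0"
    by (rule coeff_mult_nonzeroE)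
  then show "i + j \<le> total_degree F + total_degree G"
    using le_total_degree[OF ab(3)] le_total_degree[OF ab(4)] by linarith
qed

lemma total_degree_sum_le:
  assumes "\<And>a. a \<in> A \<Longrightarrow> total_degree (f a) \<le> k"
  shows "total_degree (\<Sum>a\<in>A. f a) \<le> k"
proof (unfold total_degree_le_iff, intro allI impI)
  fix i j assume "coeff (coeff (\<Sum>a\<in>A. f a) i) j \<noteq> 0"
  then have "(\<Sum>a\<in>A. coeff (coeff (f a) i) j) \<noteq> 0" by (simp add: coeff_sum)
  then obtain a where "a \<in> A" "coeff (coeff (f a) i) j \<noteq> 0"
    by (meson sum.not_neutral_contains_not_neutral)
  then show "i + j \<le> k" using assms le_total_degree order_trans by metis
qed

lemma total_degree_power_le: "total_degree (F ^ n) \<le> n * total_degree F"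
proof (induction n)
  case 0
  then show ?case
    by (metis mult_is_0 order_refl pCons_one total_degree_eq_0_iff power_0)
next
  case (Suc n)
  then show ?case using total_degree_mult_le[of F "F ^ n"] by simp
qed

text \<open>The substitution of \<open>y + c * x\<close> for \<open>y\<close>, since
  \<open>[:[:0, 1:], [:c:]:]\<close> encodes \<open>y + c * x\<close>. The expansion into monomials
  makes the bound on the total degree visible term by term.\<close>

definition shear :: "real \<Rightarrow> real poly poly \<Rightarrow> real poly poly" where
  "shear c F = (\<Sum>i\<le>degree F. \<Sum>j\<le>degree (coeff F i).
     monom [:coeff (coeff F i) j:] i * [:[:0, 1:], [:c:]:] ^ j)"

lemma poly_xy_shear: "poly_xy (shear c F) x y = poly_xy F x (y + c * x)"
  unfolding shear_def poly_xy_altdef[of F] by (simp add: algebra_simps)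

lemma shear_mult: "shear c (F * G) = shear c F * shear c G"
  by (rule poly_xy_eqI) (simp add: poly_xy_shear)

lemma shear_uminus_shear: "shear (- c) (shear c F) = F" "shear c (shear (- c) F) = F"
  by (rule poly_xy_eqI; simp add: poly_xy_shear)+

lemma total_degree_shear_le: "total_degree (shear c F) \<le> total_degree F"
proof (unfold shear_def, rule total_degree_sum_le, rule total_degree_sum_le)
  fix i j
  have *: "total_degree [:[:0, 1:], [:c:]:] \<le> 1"
    unfolding total_degree_le_iff by (auto simp: coeff_pCons split: nat.splits)
  show "total_degree (monom [:coeff (coeff F i) j:] i * [:[:0, 1:], [:c:]:] ^ j) \<le> total_degree F"
  proof (cases "coeff (coeff F i) j = 0")
    case True
    then show ?thesis by (simp add: total_degree_le_iff)
  next
    case False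
    have "total_degree (monom [:coeff (coeff F i) j:] i) \<le> i"
      unfolding total_degree_le_iff by (auto simp: coeff_pCons split: nat.splits if_splits)
    moreover have "total_degree ([:[:0, 1:], [:c:]:] ^ j) \<le> j"
      using total_degree_power_le[of "[:[:0, 1:], [:c:]:]" j] * 
      by (metis mult.right_neutral mult_le_mono2 order_trans)
    ultimately show ?thesis
      using total_degree_mult_le[of "monom [:coeff (coeff F i) j:] i" "[:[:0, 1:], [:c:]:] ^ j"]
        le_total_degree[OF False] by linarith
  qed
qed

lemma total_degree_shear: "total_degree (shear c F) = total_degree F"
  using total_degree_shear_le[of c F] total_degree_shear_le[of "- c" "shear c F"]
  by (simp add: shear_uminus_shear)

text \<open>A shear is a ring automorphism, with inverse the shear by \<open>- c\<close>, and it
  preserves total degree; a factorisation therefore pulls back with the degrees of its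
  factors.\<close>

lemma irreducible_shear:
  assumes "irreducible F"
  shows "irreducible (shear c F)"
  unfolding irreducible_bivariate_iff
proof (intro conjI allI impI)
  show "total_degree (shear c F) \<noteq> 0"
    using assms by (simp add: total_degree_shear irreducible_bivariate_iff)
next
  fix G H assume "shear c F = G * H"
  then have "F = shear (- c) G * shear (- c) H"
    by (metis shear_mult shear_uminus_shear(1))
  then show "total_degree G = 0 \<or> total_degree H = 0"
    using assms by (metis irreducible_bivariate_iff total_degree_shear)
qed

text \<open>At \<open>y = 0\<close> the sheared polynomial becomes \<open>F(x, c x)\<close>, in
  which each monomial \<open>x^i y^j\<close> of \<open>F\<close> contributes to the power
  \<open>i + j\<close> of \<open>x\<close>. For \<open>d\<close> the total degree, the sum is the
  top form of \<open>F\<close> at \<open>(1, c)\<close>.\<close>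

lemma coeff_shear_top:
  "coeff (coeff (shear c F) d) 0 = (\<Sum>j\<le>d. coeff (coeff F (d - j)) j * c ^ j)"
proof -
  let ?P = "map_poly (\<lambda>p. coeff p 0) (shear c F)"
  let ?R = "\<Sum>i\<le>degree F. \<Sum>j\<le>degree (coeff F i). monom (coeff (coeff F i) j * c ^ j) (i + j)"
  have ev: "poly (map_poly (\<lambda>p. coeff p 0) H) x = poly_xy H x 0" for H :: "real poly poly" and x
    by (induction H) (auto simp: map_poly_pCons poly_0_coeff_0)
  have "?P = ?R"
    by (rule poly_ext, unfold ev poly_xy_shear poly_xy_altdef[of F])
       (simp add: poly_sum poly_monom power_add power_mult_distrib algebra_simps)
  then have "coeff (coeff (shear c F) d) 0 = coeff ?R d"
    by (metis (no_types, lifting) coeff_0 coeff_map_poly)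
  also have "\<dots> = (\<Sum>i\<le>degree F. \<Sum>j\<le>degree (coeff F i).
      if i + j = d then coeff (coeff F i) j * c ^ j else 0)"
    by (simp add: coeff_sum)
  also have "\<dots> = (\<Sum>(i,j)\<in>(SIGMA i:{..degree F}. {..degree (coeff F i)}).
      if i + j = d then coeff (coeff F i) j * c ^ j else 0)"
    by (subst sum.Sigma) auto
  also have "\<dots> = (\<Sum>(i,j)\<in>(\<lambda>j. (d - j, j)) ` {..d}.
      if i + j = d then coeff (coeff F i) j * c ^ j else 0)"
  proof (rule sum.mono_neutral_cong)
    fix z assume "z \<in> (\<lambda>j. (d - j, j)) ` {..d} - (SIGMA i:{..degree F}. {..degree (coeff F i)})"
    then show "(case z of (i, j) \<Rightarrow> if i + j = d then coeff (coeff F i) j * c ^ j else 0) = 0"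
      by (auto intro!: le_degree)
  next
    fix z assume z: "z \<in> (SIGMA i:{..degree F}. {..degree (coeff F i)}) - (\<lambda>j. (d - j, j)) ` {..d}"
    obtain i j where [simp]: "z = (i, j)" by (cases z)
    have "i + j \<noteq> d"
    proof
      assume "i + j = d"
      then have "z = (\<lambda>j. (d - j, j)) j" "j \<in> {..d}" by auto
      with z show False by blast
    qed
    then show "(case z of (i, j) \<Rightarrow> if i + j = d then coeff (coeff F i) j * c ^ j else 0) = 0"
      by simp
  qed auto
  also have "\<dots> = (\<Sum>j\<le>d. coeff (coeff F (d - j)) j * c ^ j)"
    by (subst sum.reindex) (auto simp: inj_on_def intro!: sum.cong)
  finally show ?thesis .
qed

text \<open>The top form at \<open>(1, c)\<close> is a nonzero polynomial in \<open>c\<close> of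
  degree at most \<open>d\<close>, so one of the \<open>d + 1\<close> values
  \<open>0, ..., d\<close> is not a root. An integral \<open>c\<close> keeps integral points
  integral, and the bound \<open>c \<le> d\<close> keeps them in a box of comparable size.\<close>

lemma shear_obtains_monic:
  assumes "total_degree F = d" "d > 0"
  obtains c :: nat where "c \<le> d" "coeff (coeff (shear (real c) F) d) 0 \<noteq> 0"
proof -
  define q where "q = (\<Sum>j\<le>d. monom (coeff (coeff F (d - j)) j) j)"
  have cq: "coeff q j = (if j \<le> d then coeff (coeff F (d - j)) j else 0)" for j
    by (simp add: q_def coeff_sum)
  obtain i j where ij: "i + j = d" "coeff (coeff F i) j \<noteq> 0"
    using total_degree_attained[of F] assms by auto
  then have "coeff q j \<noteq> 0" unfolding cq by auto
  then have "q \<noteq> 0" by auto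
  have "degree q \<le> d" by (rule degree_le) (simp add: cq)
  have "\<not> real ` {..d} \<subseteq> {x. poly q x = 0}"
  proof
    assume "real ` {..d} \<subseteq> {x. poly q x = 0}"
    then have "card (real ` {..d}) \<le> card {x. poly q x = 0}"
      by (rule card_mono[OF poly_roots_finite[OF \<open>q \<noteq> 0\<close>]])
    also have "\<dots> \<le> d" using card_poly_roots_bound[OF \<open>q \<noteq> 0\<close>] \<open>degree q \<le> d\<close> by linarith
    finally show False by (simp add: card_image)
  qed
  then obtain c where "c \<le> d" "poly q (real c) \<noteq> 0" by auto
  moreover have "coeff (coeff (shear (real c) F) d) 0 = poly q (real c)"
    by (simp add: coeff_shear_top q_def poly_sum poly_monom)
  ultimately show ?thesis using that by metis
qed

section \<open>Homogeneous linear systems\<close>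

text \<open>Gaussian elimination: a nonzero coefficient of one equation eliminates one unknown,
  which lowers both numbers by one.\<close>

lemma homogeneous_system_nontrivial_solution:
  fixes M :: "'e \<Rightarrow> 'u \<Rightarrow> 'a::field"
  assumes "finite E" "finite U" "card E < card U"
  shows "\<exists>v. (\<exists>u\<in>U. v u \<noteq> 0) \<and> (\<forall>e\<in>E. (\<Sum>u\<in>U. M e u * v u) = 0)"
  using assms
proof (induction E arbitrary: U M rule: finite_induct)
  case empty
  then obtain u where "u \<in> U" by fastforce
  then show ?case by (intro exI[of _ "\<lambda>_. 1"]) auto
next
  case (insert e E)
  show ?case
  proof (cases "\<forall>u\<in>U. M e u = 0")
    case True
    moreover have "card E < card U" using insert by simp
    ultimately show ?thesis using insert.IH[of U M] insert.prems by auto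
  next
    case False
    then obtain k where k: "k \<in> U" "M e k \<noteq> 0" by blast
    define U' where "U' = U - {k}"
    have U: "finite U'" "U = insert k U'" "k \<notin> U'"
      using insert.prems k by (auto simp: U'_def)
    have "card E < card U'" using insert U by simp
    from insert.IH[OF U(1) this, of "\<lambda>e' u. M e' u - M e' k * M e u / M e k"]
    obtain v where v: "\<exists>u\<in>U'. v u \<noteq> 0"
      "\<And>e'. e' \<in> E \<Longrightarrow> (\<Sum>u\<in>U'. (M e' u - M e' k * M e u / M e k) * v u) = 0" by blast
    define v' where "v' = v(k := - (\<Sum>u\<in>U'. M e u * v u) / M e k)"
    have eq: "(\<Sum>u\<in>U. M e' u * v' u) =
        M e' k * (- (\<Sum>u\<in>U'. M e u * v u) / M e k) + (\<Sum>u\<in>U'. M e' u * v u)" for e'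
      unfolding U(2) using U by (simp add: v'_def) (intro sum.cong, auto)
    have "(\<Sum>u\<in>U. M e' u * v' u) = 0" if "e' \<in> insert e E" for e'
    proof (cases "e' = e")
      case True
      then show ?thesis using k by (simp add: eq)
    next
      case False
      then have "e' \<in> E" using that by simp
      have "(\<Sum>u\<in>U. M e' u * v' u) = (\<Sum>u\<in>U'. (M e' u - M e' k * M e u / M e k) * v u)"
        unfolding eq by (simp add: algebra_simps sum_subtractf sum_distrib_left sum_divide_distrib)
      then show ?thesis using v(2)[OF \<open>e' \<in> E\<close>] by simp
    qed
    moreover have "\<exists>u\<in>U. v' u \<noteq> 0" using v(1) U by (auto simp: v'_def)
    ultimately show ?thesis by blast
  qed
qed

text \<open>A variant of Siegel's lemma by fraction-free elimination. The exponent \<open>K\<close>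
  depends on the number of unknowns only; the family \<open>R\<close> of equations may have any
  size, because a nonzero real solution is given in advance and survives each elimination.\<close>

lemma small_integer_solution:
  "\<exists>K::nat. \<forall>(A::int) (I::'a set) (R::('a \<Rightarrow> int) set) (v::'a \<Rightarrow> real).
     2 \<le> A \<longrightarrow> finite I \<longrightarrow> card I = n \<longrightarrow> (\<forall>r\<in>R. \<forall>i\<in>I. \<bar>r i\<bar> \<le> A) \<longrightarrow>
     (\<exists>i\<in>I. v i \<noteq> 0) \<longrightarrow> (\<forall>r\<in>R. (\<Sum>i\<in>I. of_int (r i) * v i) = 0) \<longrightarrow>
     (\<exists>w::'a \<Rightarrow> int. (\<exists>i\<in>I. w i \<noteq> 0) \<and> (\<forall>i\<in>I. \<bar>w i\<bar> \<le> A ^ K) \<and>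
        (\<forall>r\<in>R. (\<Sum>i\<in>I. r i * w i) = 0))"
proof (induction n)
  case 0
  then show ?case by auto
next
  case (Suc n)
  then obtain K where IH: "\<And>(A::int) (I::'a set) (R::('a \<Rightarrow> int) set) (v::'a \<Rightarrow> real).
     2 \<le> A \<Longrightarrow> finite I \<Longrightarrow> card I = n \<Longrightarrow> (\<forall>r\<in>R. \<forall>i\<in>I. \<bar>r i\<bar> \<le> A) \<Longrightarrow>
     (\<exists>i\<in>I. v i \<noteq> 0) \<Longrightarrow> (\<forall>r\<in>R. (\<Sum>i\<in>I. of_int (r i) * v i) = 0) \<Longrightarrow>
     (\<exists>w::'a \<Rightarrow> int. (\<exists>i\<in>I. w i \<noteq> 0) \<and> (\<forall>i\<in>I. \<bar>w i\<bar> \<le> A ^ K) \<and>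
        (\<forall>r\<in>R. (\<Sum>i\<in>I. r i * w i) = 0))"
    by blast
  \<comment> \<open>Elimination turns the bound \<open>A\<close> on the coefficients into
    \<open>2 * A^2 \<le> A^3\<close>, hence the summand \<open>3 * K\<close>. Substituting back adds
    \<open>n\<close> terms of size \<open>A * A^(3 * K)\<close>, and
    \<open>n \<le> A^n\<close>.\<close>
  show ?case
  proof (rule exI[of _ "3 * K + 1 + n"], intro allI impI)
    fix A :: int and I :: "'a set" and R :: "('a \<Rightarrow> int) set" and v :: "'a \<Rightarrow> real"
    assume A: "2 \<le> A" and I: "finite I" "card I = Suc n"
      and R: "\<forall>r\<in>R. \<forall>i\<in>I. \<bar>r i\<bar> \<le> A"
      and v: "\<exists>i\<in>I. v i \<noteq> 0" "\<forall>r\<in>R. (\<Sum>i\<in>I. of_int (r i) * v i) = 0"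
    have A1: "1 \<le> A ^ j" for j using A by (simp add: one_le_power)
    show "\<exists>w::'a \<Rightarrow> int. (\<exists>i\<in>I. w i \<noteq> 0) \<and> (\<forall>i\<in>I. \<bar>w i\<bar> \<le> A ^ (3 * K + 1 + n)) \<and>
        (\<forall>r\<in>R. (\<Sum>i\<in>I. r i * w i) = 0)"
    proof (cases "\<forall>r\<in>R. \<forall>i\<in>I. r i = 0")
      case True
      have "I \<noteq> {}" using I by auto
      with True A1 show ?thesis by (intro exI[of _ "\<lambda>_. 1"]) (auto simp del: power_Suc)
    next
      case False
      then obtain r0 k where k: "r0 \<in> R" "k \<in> I" "r0 k \<noteq> 0" by blast
      define J where "J = I - {k}"
      have J: "finite J" "I = insert k J" "k \<notin> J" "card J = n"
        using I k by (auto simp: J_def)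
      define R' where "R' = (\<lambda>r i. r0 k * r i - r k * r0 i) ` R"
      have "\<exists>w::'a \<Rightarrow> int. (\<exists>i\<in>J. w i \<noteq> 0) \<and> (\<forall>i\<in>J. \<bar>w i\<bar> \<le> (A ^ 3) ^ K) \<and>
        (\<forall>r\<in>R'. (\<Sum>i\<in>J. r i * w i) = 0)"
      proof (rule IH[where v = v])
        show "2 \<le> A ^ 3" using A power_increasing[of 1 3 A] by simp
        show "\<forall>r\<in>R'. \<forall>i\<in>J. \<bar>r i\<bar> \<le> A ^ 3"
        proof (intro ballI)
          fix r i assume "r \<in> R'" "i \<in> J"
          then obtain s where s: "s \<in> R" "r = (\<lambda>i. r0 k * s i - s k * r0 i)"
            by (auto simp: R'_def)
          have *: "\<bar>s i\<bar> \<le> A" "\<bar>s k\<bar> \<le> A" "\<bar>r0 i\<bar> \<le> A" "\<bar>r0 k\<bar> \<le> A"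
            using R s k \<open>i \<in> J\<close> J by auto
          have "\<bar>r i\<bar> \<le> \<bar>r0 k\<bar> * \<bar>s i\<bar> + \<bar>s k\<bar> * \<bar>r0 i\<bar>"
            unfolding s by (metis abs_mult abs_triangle_ineq4)
          also have "\<dots> \<le> A * A + A * A"
            using * A by (intro add_mono mult_mono) auto
          also have "\<dots> \<le> A * (A * A)" using A mult_right_mono[of 2 A "A * A"] by simp
          finally show "\<bar>r i\<bar> \<le> A ^ 3" by (simp add: power3_eq_cube mult.assoc)
        qed
        \<comment> \<open>If \<open>v\<close> were supported on \<open>k\<close> alone, the pivot
          equation \<open>r0\<close> would force \<open>v k = 0\<close>.\<close>
        show "\<exists>i\<in>J. v i \<noteq> 0"
        proof (rule ccontr)
          assume *: "\<not> (\<exists>i\<in>J. v i \<noteq> 0)"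
          then have "v k \<noteq> 0" using v(1) J by auto
          moreover have "(\<Sum>i\<in>I. of_int (r0 i) * v i) = of_int (r0 k) * v k"
            unfolding J(2) using J * by simp
          ultimately show False using v(2) k by auto
        qed
        show "\<forall>r\<in>R'. (\<Sum>i\<in>J. of_int (r i) * v i) = 0"
        proof
          fix r assume "r \<in> R'"
          then obtain s where s: "s \<in> R" "r = (\<lambda>i. r0 k * s i - s k * r0 i)"
            by (auto simp: R'_def)
          have "(\<Sum>i\<in>I. of_int (r0 i) * v i) = 0" "(\<Sum>i\<in>I. of_int (s i) * v i) = 0"
            using v s k by auto
          then have "(\<Sum>i\<in>J. of_int (r0 i) * v i) = - of_int (r0 k) * v k"
            "(\<Sum>i\<in>J. of_int (s i) * v i) = - of_int (s k) * v k"
            unfolding J(2) using J by auto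
          moreover have "(\<Sum>i\<in>J. of_int (r i) * v i) =
            of_int (r0 k) * (\<Sum>i\<in>J. of_int (s i) * v i) - of_int (s k) * (\<Sum>i\<in>J. of_int (r0 i) * v i)"
            unfolding s by (simp add: algebra_simps sum_subtractf sum_distrib_left)
          ultimately show "(\<Sum>i\<in>J. of_int (r i) * v i) = 0" by simp
        qed
      qed (use J in auto)
      then obtain w where w: "\<exists>i\<in>J. w i \<noteq> 0" "\<And>i. i \<in> J \<Longrightarrow> \<bar>w i\<bar> \<le> A ^ (3 * K)"
        "\<And>s. s \<in> R \<Longrightarrow> (\<Sum>i\<in>J. (r0 k * s i - s k * r0 i) * w i) = 0"
        by (auto simp: R'_def power_mult)
      \<comment> \<open>Scaling by the pivot \<open>r0 k\<close> clears the denominator that solving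
        \<open>r0\<close> for the unknown \<open>k\<close> would introduce.\<close>
      define w' where "w' = (\<lambda>i. r0 k * w i)(k := - (\<Sum>i\<in>J. r0 i * w i))"
      have "(\<Sum>i\<in>I. r i * w' i) = 0" if "r \<in> R" for r
      proof -
        have "(\<Sum>i\<in>I. r i * w' i) = r k * w' k + (\<Sum>i\<in>J. r i * (r0 k * w i))"
          unfolding J(2) using J by (simp add: w'_def) (intro sum.cong, auto)
        also have "\<dots> = (\<Sum>i\<in>J. (r0 k * r i - r k * r0 i) * w i)"
          by (simp add: w'_def algebra_simps sum_subtractf sum_distrib_left)
        finally show ?thesis using w(3)[OF that] by simp
      qed
      moreover have "\<exists>i\<in>I. w' i \<noteq> 0" using w(1) J k by (auto simp: w'_def)
      moreover have "\<bar>w' i\<bar> \<le> A ^ (3 * K + 1 + n)" if "i \<in> I" for i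
      proof (cases "i = k")
        case True
        have "\<bar>w' i\<bar> \<le> (\<Sum>i\<in>J. \<bar>r0 i * w i\<bar>)" using True by (simp add: w'_def)
        also have "\<dots> \<le> (\<Sum>i\<in>J. A * A ^ (3 * K))"
          unfolding abs_mult using w(2) R k J A by (intro sum_mono mult_mono) auto
        also have "\<dots> = int n * A ^ (3 * K + 1)" using J by simp
        also have "\<dots> \<le> A ^ n * A ^ (3 * K + 1)"
        proof (rule mult_right_mono)
          have "int n \<le> 2 ^ n" by (metis less_exp of_nat_less_numeral_power_cancel_iff less_imp_le)
          also have "\<dots> \<le> A ^ n" using A by (intro power_mono) auto
          finally show "int n \<le> A ^ n" .
        qed (use A in auto)
        finally show ?thesis by (simp add: power_add mult_ac)
      next
        case False
        then have "i \<in> J" using that J by auto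
        then have "\<bar>w' i\<bar> \<le> A * A ^ (3 * K)"
          using False w(2) R k A by (auto simp: w'_def abs_mult intro!: mult_mono)
        also have "\<dots> \<le> A ^ n * (A * A ^ (3 * K))"
          using A A1[of n] mult_right_mono[of 1 "A ^ n" "A * A ^ (3 * K)"] by simp
        finally show ?thesis by (simp add: power_add mult_ac)
      qed
      ultimately show ?thesis by blast
    qed
  qed
qed

section \<open>Polynomials with prescribed exponents, and roots on horizontal lines\<close>

definition bipoly :: "(nat \<times> nat) set \<Rightarrow> (nat \<Rightarrow> nat \<Rightarrow> 'a) \<Rightarrow> 'a::comm_semiring_1 poly poly" where
  "bipoly I v = (\<Sum>(i,j)\<in>I. monom (monom (v i j) j) i)"

lemma coeff_bipoly:
  assumes "finite I"
  shows "coeff (coeff (bipoly I v) i) j = (if (i, j) \<in> I then v i j else 0)"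
proof -
  have "coeff (coeff (bipoly I v) i) j = (\<Sum>z\<in>I. if z = (i, j) then v i j else 0)"
    unfolding bipoly_def coeff_sum by (intro sum.cong) (auto split: if_splits)
  then show ?thesis using assms by simp
qed

lemma poly_xy_bipoly: "poly_xy (bipoly I v) x y = (\<Sum>(i,j)\<in>I. v i j * x ^ i * y ^ j)"
  unfolding bipoly_def poly_xy_sum by (intro sum.cong) (auto simp: poly_monom mult_ac)

lemma degree_bipoly_less:
  assumes "finite I" "\<And>i j. (i, j) \<in> I \<Longrightarrow> i < n" "n > 0"
  shows "degree (bipoly I v) < n"
proof -
  have "coeff (bipoly I v) i = 0" if "i \<ge> n" for i
    using that assms(1) by (intro poly_eqI) (auto simp: coeff_bipoly dest!: assms(2))
  then have "degree (bipoly I v) \<le> n - 1" by (intro degree_le) auto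
  then show ?thesis using assms by linarith
qed

lemma degree_coeff_bipoly_le:
  assumes "finite I" "\<And>i j. (i, j) \<in> I \<Longrightarrow> j \<le> n"
  shows "degree (coeff (bipoly I v) i) \<le> n"
  using assms(1) by (intro degree_le) (auto simp: coeff_bipoly dest!: assms(2))

lemma poly_xy_roots:
  fixes F :: "'a::idom poly poly"
  assumes "poly (lead_coeff F) y \<noteq> 0"
  shows "finite {x. poly_xy F x y = 0}" "card {x. poly_xy F x y = 0} \<le> degree F"
proof -
  let ?q = "map_poly (\<lambda>c. poly c y) F"
  have "coeff ?q (degree F) \<noteq> 0" using assms by (simp add: coeff_map_poly)
  then have "?q \<noteq> 0" by auto
  moreover have "degree ?q \<le> degree F" by (intro degree_le) (simp add: coeff_map_poly coeff_eq_0)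
  ultimately show "finite {x. poly_xy F x y = 0}" "card {x. poly_xy F x y = 0} \<le> degree F"
    using poly_roots_finite[of ?q] card_poly_roots_bound[of ?q] by (simp_all add: eval_inner)
qed

section \<open>A weak form of Bezout's theorem\<close>

lemma degree_coeff_mult_le:
  fixes F G :: "'a::comm_semiring_1 poly poly"
  assumes "\<And>i. degree (coeff F i) \<le> a" "\<And>i. degree (coeff G i) \<le> b"
  shows "degree (coeff (F * G) i) \<le> a + b"
  unfolding coeff_mult
proof (rule degree_sum_le)
  fix k
  show "degree (coeff F k * coeff G (i - k)) \<le> a + b"
    using degree_mult_le[of "coeff F k" "coeff G (i - k)"] assms(1)[of k] assms(2)[of "i - k"]
    by linarith
qed simp

text \<open>A substitute for the resultant in \<open>x\<close>: the coefficients of \<open>A\<close>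
  and \<open>B\<close> are unknowns, and all positive powers of \<open>x\<close> in
  \<open>B * G + A * F\<close> are required to vanish. A polynomial in \<open>y\<close> alone
  remains, and it vanishes at the common zeros.\<close>

lemma eliminant:
  fixes F G :: "real poly poly"
  assumes F: "irreducible F" "degree F = d" and d: "d \<ge> 1" and nd: "\<not> F dvd G"
    and g: "degree G \<le> g"
    and D: "\<And>i. degree (coeff F i) \<le> D" "\<And>i. degree (coeff G i) \<le> D"
  obtains r where "r \<noteq> 0" "degree r \<le> (d + g) * D + D"
    "\<And>x y. poly_xy F x y = 0 \<Longrightarrow> poly_xy G x y = 0 \<Longrightarrow> poly r y = 0"
proof -
  \<comment> \<open>Large enough for the unknowns, \<open>(d + g) * (e + 1)\<close> in number, to
    exceed the \<open>(d + g - 1) * (e + D + 1)\<close> equations.\<close>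
  define e where "e = (d + g) * D"
  define IB where "IB = {..<d} \<times> {..e}"
  define IA where "IA = {..<g} \<times> {..e}"
  have fin: "finite IB" "finite IA" by (auto simp: IA_def IB_def)
  define U where "U = IB <+> IA"
  \<comment> \<open>The range starts at \<open>1\<close>, because the coefficient of
    \<open>x^0\<close> is the eliminant and stays free.\<close>
  define Eq where "Eq = {1..<d+g} \<times> {..e+D}"
  define W where "W = case_sum (\<lambda>(i,j). monom (monom 1 j) i * G) (\<lambda>(i,j). monom (monom (1::real) j) i * F)"
  have "card Eq = (d + g - 1) * (e + D + 1)" by (simp add: Eq_def)
  moreover have "card U = (d + g) * (e + 1)"
    unfolding U_def using fin by (simp add: card_Plus) (simp add: IA_def IB_def algebra_simps)
  moreover have "(d + g - 1) * (e + D + 1) < (d + g) * (e + 1)"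
  proof -
    obtain s where s: "d + g = Suc s" using d by (cases "d + g") auto
    have "s * (e + D + 1) = s * (e + 1) + s * D" by (simp add: algebra_simps)
    also have "s * D \<le> e" unfolding e_def s by simp
    finally show ?thesis by (simp add: s)
  qed
  ultimately have "card Eq < card U" by simp
  moreover have "finite Eq" "finite U" using fin by (auto simp: Eq_def U_def)
  ultimately obtain v where v: "\<exists>u\<in>U. v u \<noteq> 0"
    "\<And>k l. (k, l) \<in> Eq \<Longrightarrow> (\<Sum>u\<in>U. coeff (coeff (W u) k) l * v u) = 0"
    using homogeneous_system_nontrivial_solution[of Eq U "\<lambda>(k, l) u. coeff (coeff (W u) k) l"]
    by fast
  define B where "B = bipoly IB (\<lambda>i j. v (Inl (i, j)))"
  define A where "A = bipoly IA (\<lambda>i j. v (Inr (i, j)))"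
  define P where "P = B * G + A * F"
  have P: "P = (\<Sum>u\<in>U. smult [:v u:] (W u))"
  proof -
    have m: "monom (monom c j) i * H = smult [:c:] (monom (monom 1 j) i * H)"
      for i j and c :: real and H
      by (simp flip: mult_smult_left add: smult_monom)
    show ?thesis
      unfolding P_def B_def A_def U_def sum.Plus[OF fin] bipoly_def sum_distrib_right
      by (intro arg_cong2[where f = "(+)"] sum.cong refl) (auto simp: W_def simp del: mult_smult_left intro!: m)
  qed
  have degB: "degree B < d" unfolding B_def using fin d by (intro degree_bipoly_less) (auto simp: IB_def)
  have degA: "degree A < g" if "g > 0"
    unfolding A_def using fin that by (intro degree_bipoly_less) (auto simp: IA_def)
  have A0: "A = 0" if "g = 0" using that by (simp add: A_def IA_def bipoly_def)
  have "degree (coeff B i) \<le> e" "degree (coeff A i) \<le> e" for i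
    unfolding A_def B_def using fin by (auto intro!: degree_coeff_bipoly_le simp: IA_def IB_def)
  then have degP: "degree (coeff P i) \<le> e + D" for i
    unfolding P_def coeff_add by (intro degree_add_le degree_coeff_mult_le D)
  have "degree (B * G) < d + g" using degB g degree_mult_le[of B G] by linarith
  moreover have "degree (A * F) < d + g"
    using degA A0 F d degree_mult_le[of A F] by (cases "g = 0") auto
  ultimately have degP': "degree P < d + g" unfolding P_def by (rule degree_add_less)
  have "coeff P k = 0" if "k \<ge> 1" for k
  proof (cases "k < d + g")
    case True
    show ?thesis
    proof (rule poly_eqI)
      fix l
      show "coeff (coeff P k) l = coeff 0 l"
      proof (cases "l \<le> e + D")
        case l: True
        have "coeff (coeff P k) l = (\<Sum>u\<in>U. coeff (coeff (W u) k) l * v u)"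
          unfolding P by (simp add: coeff_sum mult.commute)
        also have "\<dots> = 0" using v(2)[of k l] True that l by (simp add: Eq_def)
        finally show ?thesis by simp
      next
        case False
        then show ?thesis using degP[of k] by (simp add: coeff_eq_0)
      qed
    qed
  qed (use degP' in \<open>simp add: coeff_eq_0\<close>)
  then have Pc: "P = [:coeff P 0:]"
    by (intro poly_eqI) (auto simp: coeff_pCons split: nat.splits)
  \<comment> \<open>Otherwise the prime element \<open>F\<close> divides \<open>B * G\<close> and
    hence \<open>B\<close>, whose \<open>x\<close>-degree is too small; then \<open>A\<close> and
    \<open>B\<close> both vanish, against the choice of a nonzero solution.\<close>
  have "coeff P 0 \<noteq> 0"
  proof
    assume "coeff P 0 = 0"
    then have P0: "B * G = F * (- A)" using Pc by (simp add: P_def algebra_simps eq_neg_iff_add_eq_0)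
    then have "F dvd B * G" by simp
    moreover have "prime_elem F" using F(1) by (simp add: prime_elem_iff_irreducible)
    ultimately have "F dvd B" using nd by (metis prime_elem_dvd_mult_iff)
    then have "B = 0" using degB F dvd_imp_degree_le by (metis leD)
    moreover from this have "A = 0" using P0 F(1) by auto
    ultimately have z: "coeff (coeff B i) j = 0" "coeff (coeff A i) j = 0" for i j by auto
    have "v (Inl (i, j)) = 0" if "(i, j) \<in> IB" for i j
      using z(1)[of i j] that fin unfolding B_def by (simp add: coeff_bipoly)
    moreover have "v (Inr (i, j)) = 0" if "(i, j) \<in> IA" for i j
      using z(2)[of i j] that fin unfolding A_def by (simp add: coeff_bipoly)
    ultimately show False using v(1) by (auto simp: U_def)
  qed
  moreover have "poly (coeff P 0) y = 0" if "poly_xy F x y = 0" "poly_xy G x y = 0" for x y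
  proof -
    have "poly_xy P x y = 0" using that by (simp add: P_def)
    then show ?thesis using Pc by (metis poly_xy_simps(5))
  qed
  ultimately show ?thesis using that[of "coeff P 0"] degP[of 0] by (simp add: e_def)
qed

text \<open>The \<open>y\<close>-coordinate of a common zero is a root of the eliminant. Over each
  such \<open>y\<close> there are at most \<open>d\<close> values of \<open>x\<close>, because the
  leading coefficient of \<open>F\<close> in \<open>x\<close> is a nonzero constant.\<close>

lemma weak_bezout:
  fixes F G :: "real poly poly"
  assumes F: "irreducible F" "degree F = d" and d: "d \<ge> 1" and nd: "\<not> F dvd G"
    and g: "degree G \<le> d"
    and D: "\<And>i. degree (coeff F i) \<le> D" "\<And>i. degree (coeff G i) \<le> D"
    and lc: "degree (lead_coeff F) = 0"
  shows "finite {(x,y). poly_xy F x y = 0 \<and> poly_xy G x y = 0}" (is "finite ?Z")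
    and "card {(x,y). poly_xy F x y = 0 \<and> poly_xy G x y = 0} \<le> (2 * d + 1) * D * d"
proof -
  obtain r where r: "r \<noteq> 0" "degree r \<le> (d + d) * D + D"
    "\<And>x y. poly_xy F x y = 0 \<Longrightarrow> poly_xy G x y = 0 \<Longrightarrow> poly r y = 0"
    using eliminant[OF F d nd g D] by metis
  obtain c where c: "lead_coeff F = [:c:]" using lc by (metis degree_eq_zeroE)
  with F d have "poly (lead_coeff F) y \<noteq> 0" for y by auto
  note roots = poly_xy_roots[OF this, unfolded F(2)]
  let ?Y = "{y. poly r y = 0}"
  let ?T = "\<Union>y\<in>?Y. (\<lambda>x. (x, y)) ` {x. poly_xy F x y = 0}"
  have sub: "?Z \<subseteq> ?T" using r(3) by auto
  have finY: "finite ?Y" by (rule poly_roots_finite[OF r(1)])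
  then have fin: "finite ?T" using roots by auto
  show "finite ?Z" using sub fin by (rule finite_subset)
  have "card ?Z \<le> card ?T" using fin sub by (rule card_mono)
  also have "\<dots> \<le> (\<Sum>y\<in>?Y. card ((\<lambda>x. (x, y)) ` {x. poly_xy F x y = 0}))"
    by (rule card_UN_le[OF finY])
  also have "\<dots> \<le> (\<Sum>y\<in>?Y. d)"
    by (rule sum_mono) (metis roots card_image_le order_trans)
  also have "\<dots> = card ?Y * d" by simp
  also have "\<dots> \<le> ((d + d) * D + D) * d"
    using card_poly_roots_bound[OF r(1)] r(2) by (intro mult_right_mono) auto
  finally show "card ?Z \<le> (2 * d + 1) * D * d" by (simp add: algebra_simps)
qed

section \<open>Hensel lifting and the pigeonhole principle\<close>

lemma poly_dvd_diff:
  fixes q :: "'a::comm_ring_1 poly"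
  shows "(a - b) dvd (poly q a - poly q b)"
proof (induction q)
  case (pCons c q)
  have "poly (pCons c q) a - poly (pCons c q) b = (a - b) * poly q a + b * (poly q a - poly q b)"
    by (simp add: algebra_simps)
  with pCons show ?case by simp
qed simp

lemma poly_taylor_dvd:
  fixes q :: "'a::idom poly"
  shows "(a - b)\<^sup>2 dvd (poly q a - poly q b - (a - b) * poly (pderiv q) b)"
proof (induction q)
  case (pCons c q)
  have "poly (pCons c q) a - poly (pCons c q) b - (a - b) * poly (pderiv (pCons c q)) b =
      (a - b) * (poly q a - poly q b) + b * (poly q a - poly q b - (a - b) * poly (pderiv q) b)"
    by (simp add: pderiv_pCons algebra_simps)
  moreover have "(a - b)\<^sup>2 dvd (a - b) * (poly q a - poly q b)"
    unfolding power2_eq_square by (intro mult_dvd_mono poly_dvd_diff) simp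
  ultimately show ?case using pCons by simp
qed simp

lemma pderiv_eval_inner:
  fixes F :: "'a::idom poly poly"
  shows "pderiv (map_poly (\<lambda>c. poly c y) F) = map_poly (\<lambda>c. poly c y) (pderiv F)"
  by (rule poly_eqI) (simp add: coeff_map_poly coeff_pderiv)

lemma poly_xy_dvd_diff:
  fixes F :: "'a::idom poly poly"
  assumes "p dvd x - x'" "p dvd y - y'"
  shows "p dvd poly_xy F x y - poly_xy F x' y'"
proof -
  have "p dvd poly_xy F x y - poly_xy F x' y"
    using poly_dvd_diff[of x x' "map_poly (\<lambda>c. poly c y) F"] assms(1)
    by (simp add: eval_inner) (metis dvd_trans)
  moreover have "p dvd poly_xy F x' y - poly_xy F x' y'"
    using poly_dvd_diff[of y y' "poly F [:x':]"] assms(2) unfolding poly_xy_def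
    by (metis dvd_trans)
  ultimately show ?thesis by (metis add_diff_eq diff_add_cancel dvd_add)
qed

lemma poly_poly_eq_poly_xy: "poly (poly F h) y = poly_xy F (poly h y) y"
  by (induction F) auto

text \<open>Newton's iteration carried out on a polynomial \<open>h\<close> in \<open>y\<close>, so
  that one \<open>h\<close> serves all zeros of \<open>F\<close> in the residue class. The
  correction uses an inverse \<open>b\<close> of the derivative modulo \<open>p\<close> at the base
  point only, so each step gains one power of \<open>p\<close>.\<close>

lemma hensel_polynomial:
  fixes F :: "int poly poly" and p x0 y0 :: int
  assumes "coprime (poly_xy (pderiv F) x0 y0) p" and "m \<ge> 1"
  shows "\<exists>h. \<forall>x y. p dvd x - x0 \<longrightarrow> p dvd y - y0 \<longrightarrow> poly_xy F x y = 0 \<longrightarrow> p ^ m dvd x - poly h y"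
  using assms(2)
proof (induction m rule: dec_induct)
  case base
  show ?case by (intro exI[of _ "[:x0:]"]) auto
next
  case (step m)
  obtain h where h: "\<And>x y. p dvd x - x0 \<Longrightarrow> p dvd y - y0 \<Longrightarrow> poly_xy F x y = 0 \<Longrightarrow> p ^ m dvd x - poly h y"
    using step by blast
  obtain b where "[poly_xy (pderiv F) x0 y0 * b = 1] (mod p)"
    using assms(1) cong_solve_coprime_int by blast
  then have b: "p dvd poly_xy (pderiv F) x0 y0 * b - 1" by (simp add: cong_iff_dvd_diff)
  show ?case
  proof (intro exI[of _ "h - smult b (poly F h)"] allI impI)
    fix x y assume xy: "p dvd x - x0" "p dvd y - y0" "poly_xy F x y = 0"
    define u where "u = poly h y - x"
    define D where "D = poly_xy (pderiv F) x y"
    have u: "p ^ m dvd u" using h[OF xy] unfolding u_def by (metis dvd_minus_iff minus_diff_eq)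
    have "u\<^sup>2 dvd poly_xy F (poly h y) y - u * D"
      using poly_taylor_dvd[of "poly h y" x "map_poly (\<lambda>c. poly c y) F"] xy(3)
      by (simp add: eval_inner pderiv_eval_inner u_def D_def)
    \<comment> \<open>Here \<open>2 * m \<ge> m + 1\<close>, which is why the induction starts at
      \<open>m = 1\<close>.\<close>
    moreover have "p ^ Suc m dvd u\<^sup>2"
    proof -
      have "p ^ Suc m dvd p ^ (m + m)" using step by (intro le_imp_power_dvd) simp
      also have "\<dots> dvd u\<^sup>2" unfolding power2_eq_square power_add using u by (intro mult_dvd_mono)
      finally show ?thesis .
    qed
    ultimately have 1: "p ^ Suc m dvd b * (poly_xy F (poly h y) y - u * D)"
      by (meson dvd_mult dvd_trans)
    have "p dvd D - poly_xy (pderiv F) x0 y0"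
      unfolding D_def using xy(1,2) by (rule poly_xy_dvd_diff)
    then have "p dvd b * (D - poly_xy (pderiv F) x0 y0) + (poly_xy (pderiv F) x0 y0 * b - 1)"
      using b by (intro dvd_add dvd_mult)
    then have "p dvd b * D - 1" by (simp add: algebra_simps)
    then have 2: "p ^ Suc m dvd u * (b * D - 1)"
      using u by (metis mult_dvd_mono power_Suc2)
    \<comment> \<open>The new error splits into a multiple of the Taylor remainder, divisible by
      \<open>u\<^sup>2\<close>, and \<open>u\<close> times a multiple of \<open>p\<close>.\<close>
    have "x - poly (h - smult b (poly F h)) y =
        b * (poly_xy F (poly h y) y - u * D) + u * (b * D - 1)"
      by (simp add: poly_poly_eq_poly_xy u_def algebra_simps)
    then show "p ^ Suc m dvd x - poly (h - smult b (poly F h)) y"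
      using 1 2 by simp
  qed
qed

section \<open>Pigeonhole principle and the auxiliary curve\<close>

lemma sum_decreasing: "(\<Sum>k<m. m - k) = m * (m + 1) div (2::nat)"
proof -
  have "(\<Sum>k<m. m - k) = (\<Sum>k<m. Suc k)"
    by (rule sum.reindex_bij_witness[of _ "\<lambda>k. m - Suc k" "\<lambda>k. m - Suc k"]) auto
  also have "2 * \<dots> = m * (m + 1)" by (induction m) (auto simp: algebra_simps)
  finally show ?thesis by simp
qed

text \<open>The coefficient of \<open>t^k\<close> in a combination only matters modulo \<open>q^(m-k)\<close>, because it is
  evaluated at multiples of \<open>q\<close>; so there are \<open>q^(m(m+1)/2)\<close> pigeonholes.\<close>

lemma small_combination_vanishing_mod:
  fixes W :: "'a \<Rightarrow> int poly" and b :: "'a \<Rightarrow> nat" and q m :: nat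
  assumes A: "finite A" and q: "q > 0"
    and less: "q ^ (m * (m + 1) div 2) < (\<Prod>a\<in>A. b a + 1)"
  shows "\<exists>\<delta>::'a \<Rightarrow> int. (\<exists>a\<in>A. \<delta> a \<noteq> 0) \<and> (\<forall>a\<in>A. \<bar>\<delta> a\<bar> \<le> int (b a)) \<and>
     (\<forall>t. int q ^ m dvd poly (\<Sum>a\<in>A. smult (\<delta> a) (W a)) (int q * t))"
proof -
  define \<Phi> where "\<Phi> g = (\<Sum>a\<in>A. smult (g a) (W a))" for g :: "'a \<Rightarrow> int"
  define X where "X = (\<Pi>\<^sub>E a\<in>A. {0..int (b a)})"
  define Y where "Y = (\<Pi>\<^sub>E k\<in>{..<m}. {0..<int q ^ (m - k)})"
  define f where "f g = restrict (\<lambda>k. coeff (\<Phi> g) k mod int q ^ (m - k)) {..<m}" for g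
  have "f ` X \<subseteq> Y" using q by (auto simp: f_def Y_def PiE_iff extensional_def split: if_splits)
  moreover have finY: "finite Y" unfolding Y_def by (intro finite_PiE) auto
  ultimately have "card (f ` X) \<le> card Y" by (intro card_mono)
  also have "card Y = (\<Prod>k<m. q ^ (m - k))"
    unfolding Y_def by (subst card_PiE) (auto simp: nat_power_eq)
  also have "\<dots> = q ^ (m * (m + 1) div 2)"
    by (simp flip: power_sum add: sum_decreasing)
  also have "\<dots> < card X" unfolding X_def using less A by (subst card_PiE) (auto simp: nat_add_distrib)
  finally have "\<not> inj_on f X" using card_image by fastforce
  then obtain g g' where g: "g \<in> X" "g' \<in> X" "f g = f g'" "g \<noteq> g'" by (auto simp: inj_on_def)
  \<comment> \<open>Two vectors in the same pigeonhole; as their entries lie between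
    \<open>0\<close> and \<open>b a\<close>, the difference obeys the bound \<open>b a\<close>
    without a factor \<open>2\<close>.\<close>
  define \<delta> where "\<delta> a = g a - g' a" for a
  have "\<exists>a\<in>A. \<delta> a \<noteq> 0"
  proof (rule ccontr)
    assume "\<not> (\<exists>a\<in>A. \<delta> a \<noteq> 0)"
    then have "g = g'" using g by (intro PiE_ext[of g A _ g']) (auto simp: X_def \<delta>_def)
    then show False using g by simp
  qed
  moreover have "\<bar>\<delta> a\<bar> \<le> int (b a)" if "a \<in> A" for a
  proof -
    have "g a \<in> {0..int (b a)}" "g' a \<in> {0..int (b a)}" using g that by (auto simp: X_def)
    then show ?thesis by (auto simp: \<delta>_def)
  qed
  moreover have "int q ^ m dvd poly (\<Phi> \<delta>) (int q * t)" for t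
    unfolding poly_altdef
  proof (rule dvd_sum)
    fix k
    show "int q ^ m dvd coeff (\<Phi> \<delta>) k * (int q * t) ^ k"
    \<comment> \<open>For \<open>k < m\<close> the collision supplies \<open>q^(m-k)\<close> and the
      argument \<open>q * t\<close> supplies \<open>q^k\<close>; from \<open>k = m\<close> on the
      argument suffices.\<close>
    proof (cases "k < m")
      case True
      have "\<Phi> \<delta> = \<Phi> g - \<Phi> g'" by (simp add: \<Phi>_def \<delta>_def smult_diff_left sum_subtractf)
      moreover have "coeff (\<Phi> g) k mod int q ^ (m - k) = coeff (\<Phi> g') k mod int q ^ (m - k)"
        using fun_cong[OF g(3), of k] True by (simp add: f_def)
      ultimately have "int q ^ (m - k) dvd coeff (\<Phi> \<delta>) k"
        by (simp add: mod_eq_dvd_iff)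
      then have "int q ^ (m - k) * int q ^ k dvd coeff (\<Phi> \<delta>) k * (int q * t) ^ k"
        by (intro mult_dvd_mono) (auto simp: power_mult_distrib)
      then show ?thesis using True by (simp flip: power_add)
    next
      case False
      then have "int q ^ m dvd int q ^ k" by (intro le_imp_power_dvd) simp
      then show ?thesis by (simp add: power_mult_distrib)
    qed
  qed
  ultimately show ?thesis unfolding \<Phi>_def by blast
qed


text \<open>The total exponent of \<open>M\<close> lost in the product of the coefficient bounds,
  doubled to avoid a division.\<close>

lemma sum_weights:
  "2 * (\<Sum>(i,j)\<in>{..<d} \<times> {..<E}. d + j) = d * E * (2 * d + E - 1 :: nat)"
proof (cases "E = 0")
  case False
  have "2 * (\<Sum>j<E. d + j) = E * (2 * d + E - 1)"
  proof (induction E)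
    case (Suc E)
    then show ?case by (cases E) (auto simp: algebra_simps)
  qed simp
  then show ?thesis by (simp flip: sum.cartesian_product add: mult.left_commute)
qed simp

text \<open>The right side is the product of the coefficient bounds, with \<open>s\<close> the total
  weight, and the left side the number of pigeonholes. After squaring, both are \<open>n\<close>-th
  powers, and \<open>p^(2n) = p^(n+1) * p^(n-1)\<close> leaves the factor \<open>p^(n-1)\<close> to
  pay for \<open>(n + 1)^2 * M^k\<close>.\<close>

lemma pigeonhole_margin:
  fixes p M :: real
  assumes p: "p \<ge> 1" and M: "M \<ge> 1" and n: "n \<ge> 1"
    and large: "(real n + 1)\<^sup>2 * M ^ k \<le> p ^ (n - 1)" and s: "2 * s = n * k"
  shows "p ^ (n * (n + 1) div 2) \<le> (p ^ n / (real n + 1)) ^ n / M ^ s"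
proof (rule power2_le_imp_le)
  have "p ^ (n + 1) * ((real n + 1)\<^sup>2 * M ^ k) \<le> p ^ (n + 1) * p ^ (n - 1)"
    using large p by (intro mult_left_mono) auto
  also have "\<dots> = (p ^ n)\<^sup>2"
    using n by (cases n) (simp_all add: power2_eq_square)
  finally have *: "p ^ (n + 1) \<le> (p ^ n / (real n + 1))\<^sup>2 / M ^ k"
    using M by (simp add: divide_simps add_nonneg_eq_0_iff mult_ac)
  have "n * (n + 1) div 2 * 2 = (n + 1) * n" by simp
  then have "(p ^ (n * (n + 1) div 2))\<^sup>2 = (p ^ (n + 1)) ^ n"
    by (simp only: power_mult[symmetric])
  also have "\<dots> \<le> ((p ^ n / (real n + 1))\<^sup>2 / M ^ k) ^ n"
    using * p by (intro power_mono) auto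
  also have "\<dots> = ((p ^ n / (real n + 1)) ^ n)\<^sup>2 / M ^ (n * k)"
  proof -
    have "(q\<^sup>2 / M ^ k) ^ n = (q ^ n)\<^sup>2 / M ^ (n * k)" for q
      by (simp add: power_divide mult.commute flip: power_mult)
    then show ?thesis .
  qed
  also have "\<dots> = ((p ^ n / (real n + 1)) ^ n / M ^ s)\<^sup>2"
  proof -
    have "(q ^ n)\<^sup>2 / M ^ (2 * s) = (q ^ n / M ^ s)\<^sup>2" for q
      by (simp add: power_divide mult.commute flip: power_mult)
    then show ?thesis unfolding s .
  qed
  finally show "(p ^ (n * (n + 1) div 2))\<^sup>2 \<le> ((p ^ n / (real n + 1)) ^ n / M ^ s)\<^sup>2" .
qed (use p M in auto)

text \<open>All integral points of \<open>F\<close> in one simple residue class modulo \<open>p\<close> lie on a second curve.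
  The coefficient of \<open>x^i y^j\<close> is allowed to be of size \<open>p^n / ((n + 1) M^(d + j))\<close>: then a value
  divisible by \<open>p^n\<close> must vanish.\<close>

lemma auxiliary_curve:
  fixes F :: "int poly poly" and x0 y0 :: int and p d E M :: nat
  assumes cop: "coprime (poly_xy (pderiv F) x0 y0) (int p)"
    and d: "d \<ge> 1" and E: "E \<ge> 1" and M: "M \<ge> 1" and p: "p \<ge> 1" and n: "n = d * E"
    and large: "(real n + 1)\<^sup>2 * real M ^ (2 * d + E - 1) \<le> real p ^ (n - 1)"
  obtains G :: "real poly poly" where "G \<noteq> 0" "degree G < d" "\<And>i. degree (coeff G i) \<le> E"
    "\<And>x y. \<bar>x\<bar> \<le> int M \<Longrightarrow> \<bar>y\<bar> \<le> int M \<Longrightarrow> int p dvd x - x0 \<Longrightarrow> int p dvd y - y0 \<Longrightarrow>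
       poly_xy F x y = 0 \<Longrightarrow> poly_xy G (of_int x) (of_int y) = 0"
proof -
  define I where "I = {..<d} \<times> {..<E}"
  have fin: "finite I" and card: "card I = n" by (auto simp: I_def n)
  have n1: "n \<ge> 1" using d E by (simp add: n)
  \<comment> \<open>Each of the \<open>n\<close> monomials will contribute at most \<open>c\<close>,
    and \<open>n * c\<close> is strictly below \<open>p^n\<close>.\<close>
  define c where "c = real p ^ n / (real n + 1)"
  have c: "c > 0" using p by (simp add: c_def)
  define b where "b = (\<lambda>(i::nat,j). nat \<lfloor>c / real M ^ (d + j)\<rfloor>)"
  have M0: "real M ^ k > 0" for k using M by simp
  have b: "real (b (i, j)) \<le> c / real M ^ (d + j)" for i j
    using c M0[of "d + j"] by (simp add: b_def)
  obtain h where h: "\<And>x y. int p dvd x - x0 \<Longrightarrow> int p dvd y - y0 \<Longrightarrow> poly_xy F x y = 0 \<Longrightarrow>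
      int p ^ n dvd x - poly h y"
    using hensel_polynomial[OF cop n1] by blast
  \<comment> \<open>The monomial \<open>x^i y^j\<close> with \<open>x\<close> replaced by
    \<open>h(y)\<close>, expanded around \<open>y0\<close>: on the residue class the new variable
    \<open>y - y0\<close> is a multiple of \<open>p\<close>.\<close>
  define W where "W = (\<lambda>(i,j). (h \<circ>\<^sub>p [:y0, 1:]) ^ i * [:y0, 1:] ^ j)"
  have "real (p ^ (n * (n + 1) div 2)) \<le> c ^ n / real M ^ (\<Sum>(i,j)\<in>I. d + j)"
    unfolding c_def of_nat_power
    by (rule pigeonhole_margin[where k = "2 * d + E - 1"])
       (use p M n1 large sum_weights[of d E] in \<open>auto simp: I_def n\<close>)
  also have "\<dots> = (\<Prod>z\<in>I. c / real M ^ (d + snd z))"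
    by (simp add: prod_dividef card power_sum case_prod_beta)
  \<comment> \<open>Strictness comes from \<open>a < \<lfloor>a\<rfloor> + 1\<close> in each factor;
    the pigeonhole principle needs it.\<close>
  also have "\<dots> < (\<Prod>z\<in>I. real (b z + 1))"
  proof -
    have *: "0 < c / real M ^ (d + snd z)" "c / real M ^ (d + snd z) < real (b z + 1)" for z
      using c M0[of "d + snd z"] by (simp, cases z) (simp add: b_def, linarith)
    have "(0, 0) \<in> I" using d E by (auto simp: I_def)
    then show ?thesis
    proof (rule prod_mono_strict)
      show "c / real M ^ (d + snd (0::nat, 0::nat)) < real (b (0, 0) + 1)" by (rule *)
      show "0 \<le> c / real M ^ (d + snd z) \<and> c / real M ^ (d + snd z) \<le> real (b z + 1)"
        for z :: "nat \<times> nat"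
        using *[of z] by linarith
    qed (use fin in auto)
  qed
  also have "\<dots> = real (\<Prod>z\<in>I. b z + 1)" by simp
  finally have "p ^ (n * (n + 1) div 2) < (\<Prod>z\<in>I. b z + 1)" by (simp only: of_nat_less_iff)
  from small_combination_vanishing_mod[OF fin _ this, of W] p
  obtain \<delta> where \<delta>: "\<exists>z\<in>I. \<delta> z \<noteq> 0" "\<And>z. z \<in> I \<Longrightarrow> \<bar>\<delta> z\<bar> \<le> int (b z)"
    "\<And>t. int p ^ n dvd poly (\<Sum>z\<in>I. smult (\<delta> z) (W z)) (int p * t)" by auto
  define Gi where "Gi = bipoly I (\<lambda>i j. \<delta> (i, j))"
  define G where "G = bipoly I (\<lambda>i j. real_of_int (\<delta> (i, j)))"
  have "G \<noteq> 0"
  proof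
    assume "G = 0"
    then have "coeff (coeff G i) j = 0" for i j by simp
    then have "\<delta> (i, j) = 0" if "(i, j) \<in> I" for i j
      using that unfolding G_def coeff_bipoly[OF fin] by (metis of_int_eq_0_iff)
    with \<delta>(1) show False by auto
  qed
  moreover have "degree G < d"
    unfolding G_def using fin d by (intro degree_bipoly_less) (auto simp: I_def)
  moreover have "degree (coeff G i) \<le> E" for i
    unfolding G_def using fin by (intro degree_coeff_bipoly_le) (auto simp: I_def)
  moreover have "poly_xy G (of_int x) (of_int y) = 0"
    if xy: "\<bar>x\<bar> \<le> int M" "\<bar>y\<bar> \<le> int M" "int p dvd x - x0" "int p dvd y - y0" "poly_xy F x y = 0" for x y
  proof -
    obtain t where t: "y - y0 = int p * t" using xy(4) by blast
    have "poly (\<Sum>z\<in>I. smult (\<delta> z) (W z)) (int p * t) = poly_xy Gi (poly h y) y"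
      unfolding Gi_def poly_xy_bipoly poly_sum t[symmetric]
      by (intro sum.cong) (auto simp: W_def poly_pcompose)
    then have 1: "int p ^ n dvd poly_xy Gi (poly h y) y" using \<delta>(3)[of t] by simp
    \<comment> \<open>Hensel's congruence transfers the divisibility from the point
      \<open>(h(y), y)\<close> to the actual point \<open>(x, y)\<close>.\<close>
    have "int p ^ n dvd poly_xy Gi x y - poly_xy Gi (poly h y) y"
      using h[OF xy(3-5)] by (intro poly_xy_dvd_diff) auto
    then have dvd: "int p ^ n dvd poly_xy Gi x y" using 1 dvd_add_left_iff[OF 1] by (metis diff_add_cancel)
    have "\<bar>real_of_int (poly_xy Gi x y)\<bar> \<le> (\<Sum>(i,j)\<in>I. \<bar>real_of_int (\<delta> (i,j) * x ^ i * y ^ j)\<bar>)"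
      unfolding Gi_def poly_xy_bipoly by (simp add: case_prod_beta)
    also have "\<dots> \<le> (\<Sum>z\<in>I. c)"
    proof (rule sum_mono, clarify)
      fix i j assume ij: "(i, j) \<in> I"
      have "\<bar>real_of_int x\<bar> ^ i * \<bar>real_of_int y\<bar> ^ j \<le> real M ^ i * real M ^ j"
        using xy(1,2) by (intro mult_mono power_mono) auto
      also have "\<dots> \<le> real M ^ (d + j)"
        using ij M unfolding power_add[symmetric] by (intro power_increasing) (auto simp: I_def)
      finally have "\<bar>real_of_int (\<delta> (i,j))\<bar> * (\<bar>real_of_int x\<bar> ^ i * \<bar>real_of_int y\<bar> ^ j) \<le>
          (c / real M ^ (d + j)) * real M ^ (d + j)"
        using \<delta>(2)[OF ij] b[of i j] c M0[of "d + j"] by (intro mult_mono) auto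
      also have "\<dots> = c" using M0[of "d + j"] by simp
      finally show "\<bar>real_of_int (\<delta> (i,j) * x ^ i * y ^ j)\<bar> \<le> c"
        by (simp add: abs_mult power_abs mult.assoc)
    qed
    also have "\<dots> = real n * real p ^ n / (real n + 1)" by (simp add: card c_def)
    also have "\<dots> < real p ^ n" using p by (simp add: field_simps)
    finally have "\<bar>poly_xy Gi x y\<bar> < int p ^ n"
      by (metis of_int_abs of_int_less_iff of_int_of_nat_eq of_int_power)
    then have "poly_xy Gi x y = 0" using dvd zdvd_not_zless[of "\<bar>poly_xy Gi x y\<bar>" "int p ^ n"] by auto
    moreover have "poly_xy G (of_int x) (of_int y) = real_of_int (poly_xy Gi x y)"
      unfolding G_def Gi_def poly_xy_bipoly by (simp add: case_prod_beta)
    ultimately show ?thesis by simp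
  qed
  ultimately show ?thesis by (rule that)
qed

section \<open>Primes and roots modulo primes\<close>

text \<open>The quotient is \<open>L\<close> times the integral of \<open>x^k (1 - x)^m\<close> over
  \<open>[0, 1]\<close>. Expanded, that integral has denominators
  \<open>k + 1, ..., k + m + 1\<close> only; the induction uses
  \<open>x^k (1 - x)^(m+1) = x^k (1 - x)^m - x^(k+1) (1 - x)^m\<close> instead.\<close>

lemma common_multiple_factorial_quotient:
  assumes "\<And>i. i \<in> {Suc k..Suc (k + m)} \<Longrightarrow> i dvd L"
  shows "real L * fact k * fact m / fact (Suc (k + m)) \<in> \<int>"
  using assms
proof (induction m arbitrary: k)
  case 0
  have "Suc k dvd L" using 0[of "Suc k"] by simp
  then obtain c where c: "L = Suc k * c" by blast
  have "real L * fact k * fact 0 / fact (Suc (k + 0)) = real c"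
    unfolding c by (simp add: divide_simps algebra_simps add_nonneg_eq_0_iff)
  then show ?case by simp
next
  case (Suc m)
  have "real L * fact k * fact m / fact (Suc (k + m)) \<in> \<int>"
    "real L * fact (Suc k) * fact m / fact (Suc (Suc k + m)) \<in> \<int>"
    using Suc.prems by (intro Suc.IH; force)+
  moreover have "real L * fact k * fact (Suc m) / fact (Suc (k + Suc m)) =
     real L * fact k * fact m / fact (Suc (k + m)) -
     real L * fact (Suc k) * fact m / fact (Suc (Suc k + m))"
  proof -
    have "(fact (Suc (Suc (k + m))) :: real) = (real k + real m + 2) * fact (Suc (k + m))"
      by (simp only: fact_Suc[of "Suc (k + m)"]) simp
    moreover define z where "z = (fact (Suc (k + m)) :: real)"
    moreover have "z > 0" by (simp add: z_def)
    ultimately show ?thesis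
      by (simp add: divide_simps del: fact_Suc) (simp add: algebra_simps)
  qed
  ultimately show ?case by (metis Ints_diff)
qed

text \<open>With \<open>n = k + 1\<close> this is the estimate
  \<open>4^n \<le> 2 * n * (2 n choose n)\<close>, free of divisions.\<close>

lemma four_power_le_factorial: "4 ^ Suc k * fact (Suc k) * fact k \<le> (2 * fact (2 * Suc k) :: nat)"
proof (induction k)
  case (Suc k)
  have "(4::nat) ^ Suc (Suc k) * fact (Suc (Suc k)) * fact (Suc k) =
      4 * ((k + 2) * (k + 1)) * (4 ^ Suc k * fact (Suc k) * fact k)"
    by (simp add: algebra_simps)
  also have "\<dots> \<le> ((2 * k + 4) * (2 * k + 3)) * (2 * fact (2 * Suc k))"
  proof (rule mult_mono[OF _ Suc])
    show "4 * ((k + 2) * (k + 1)) \<le> (2 * k + 4) * (2 * k + 3)" by (simp add: algebra_simps)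
  qed auto
  also have "\<dots> = 2 * fact (2 * Suc (Suc k))"
    by (simp add: algebra_simps)
  finally show ?case .
qed (simp add: numeral_2_eq_2)

text \<open>Nair's argument: any common multiple \<open>L\<close> of \<open>1, \<dots>, 2 n\<close> is at least
  \<open>n * (2 n choose n)\<close>, since \<open>L / (n * (2 n choose n))\<close> is a combination of \<open>L / n, \<dots>, L / (2 n)\<close>.\<close>

lemma chebyshev_lower:
  assumes "n \<ge> 1"
  shows "4 ^ n \<le> 2 * (2 * n) ^ card {p::nat. prime p \<and> p \<le> 2 * n}"
proof -
  define S where "S = {p::nat. prime p \<and> p \<le> 2 * n}"
  define e where "e p = (GREATEST k. p ^ k \<le> 2 * n)" for p
  \<comment> \<open>The least common multiple of \<open>1, ..., 2 * n\<close>, written so that every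
    prime visibly contributes at most \<open>2 * n\<close>.\<close>
  define L where "L = (\<Prod>p\<in>S. p ^ e p)"
  have finS: "finite S" unfolding S_def by (rule finite_subset[of _ "{..2*n}"]) auto
  have bound: "k \<le> 2 * n" if "prime p" "p ^ k \<le> 2 * n" for p k :: nat
  proof -
    have "k < 2 ^ k" by (rule less_exp)
    also have "\<dots> \<le> p ^ k" using prime_ge_2_nat[OF that(1)] by (rule power_mono) simp
    finally show ?thesis using that by simp
  qed
  have e: "p ^ e p \<le> 2 * n" if "prime p" for p
    unfolding e_def
    using GreatestI_nat[of "\<lambda>k. p ^ k \<le> 2 * n" 0 "2 * n"] assms bound[OF that] by simp
  have e': "k \<le> e p" if "prime p" "p ^ k \<le> 2 * n" for p k
    unfolding e_def
    using Greatest_le_nat[of "\<lambda>k. p ^ k \<le> 2 * n" k "2 * n"] that bound[OF that(1)] by simp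
  have "L > 0" unfolding L_def by (intro prod_pos) (auto simp: S_def prime_gt_0_nat)
  have dvd: "i dvd L" if i: "i \<ge> 1" "i \<le> 2 * n" for i
  proof (rule multiplicity_le_imp_dvd)
    fix p :: nat assume p: "prime p"
    have "p ^ multiplicity p i \<le> i" using i by (intro dvd_imp_le multiplicity_dvd) auto
    then have mi: "p ^ multiplicity p i \<le> 2 * n" using i by simp
    show "multiplicity p i \<le> multiplicity p L"
    proof (cases "p \<in> S")
      case True
      then have "multiplicity p L = e p"
        unfolding L_def using multiplicity_prod_prime_powers[OF finS _ p, of e] by (auto simp: S_def)
      then show ?thesis using e'[OF p mi] by simp
    next
      case False
      then have "\<not> p dvd i" using i p by (auto simp: S_def dest: dvd_imp_le)
      then show ?thesis by (simp add: not_dvd_imp_multiplicity_0)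
    qed
  qed (use i in auto)
  obtain k where k: "n = Suc k" using assms by (cases n) auto
  have "real L * fact k * fact (Suc k) / fact (Suc (k + Suc k)) \<in> \<int>"
    by (rule common_multiple_factorial_quotient) (auto intro!: dvd simp: k)
  moreover have "real L * fact k * fact (Suc k) / fact (Suc (k + Suc k)) > 0"
    using \<open>L > 0\<close> by (intro divide_pos_pos mult_pos_pos) auto
  ultimately have "real L * fact k * fact (Suc k) / fact (Suc (k + Suc k)) \<ge> 1"
    by (metis Ints_cases of_int_0_less_iff of_int_1_le_iff int_one_le_iff_zero_less)
  then have "fact (Suc (k + Suc k)) \<le> real L * fact k * fact (Suc k)"
    by (simp add: divide_simps del: fact_Suc split: if_splits)
  then have "real (fact (2 * Suc k)) \<le> real (L * fact k * fact (Suc k))"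
    by (simp add: mult_2 del: fact_Suc)
  then have "fact (2 * Suc k) \<le> L * fact k * fact (Suc k)" by (simp only: of_nat_le_iff)
  then have "2 * fact (2 * Suc k) \<le> 2 * (L * fact k * fact (Suc k))" by (rule mult_le_mono2)
  moreover have "4 ^ n * (fact (Suc k) * fact k) \<le> (2 * fact (2 * Suc k) :: nat)"
    using four_power_le_factorial[of k] by (simp only: k mult.assoc)
  ultimately have "4 ^ n * (fact (Suc k) * fact k) \<le> 2 * (L * fact k * fact (Suc k))"
    by (rule order_trans[rotated])
  also have "\<dots> = (2 * L) * (fact (Suc k) * fact k)" by (simp only: mult_ac)
  finally have "4 ^ n * (fact (Suc k) * fact k) \<le> (2 * L) * (fact (Suc k) * fact k)" .
  then have "4 ^ n \<le> 2 * L" by (simp only: mult_le_cancel2) simp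
  also have "L \<le> (\<Prod>p\<in>S. 2 * n)" unfolding L_def by (intro prod_mono) (auto simp: S_def e)
  also have "\<dots> = (2 * n) ^ card S" by simp
  finally show ?thesis by (simp add: S_def)
qed

section \<open>Lagrange's bound for roots modulo a prime\<close>

lemma card_roots_mod_prime:
  fixes q :: "int poly" and p :: nat
  assumes "prime p" "\<not> int p dvd lead_coeff q"
  shows "card {x\<in>{0..<int p}. int p dvd poly q x} \<le> degree q"
  using assms(2)
proof (induction "degree q" arbitrary: q)
  case 0
  then obtain c where "q = [:c:]" by (metis degree_eq_zeroE)
  with 0 show ?case by simp
next
  case (Suc n)
  show ?case
  proof (cases "\<exists>x0\<in>{0..<int p}. int p dvd poly q x0")
    case False
    then have "{x\<in>{0..<int p}. int p dvd poly q x} = {}" by blast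
    then show ?thesis by (simp only: card.empty)
  next
    case True
    then obtain x0 where x0: "x0 \<in> {0..<int p}" "int p dvd poly q x0" by blast
    define s where "s = synthetic_div q x0"
    have q: "q = [:- x0, 1:] * s + [:poly q x0:]" by (simp only: s_def synthetic_div_correct')
    have ds: "degree s = n" using Suc.hyps(2) by (simp add: s_def degree_synthetic_div)
    \<comment> \<open>Splitting off a monic linear factor keeps the leading coefficient, so the
      quotient still has degree \<open>n\<close> modulo \<open>p\<close>.\<close>
    have "coeff q (Suc n) = coeff s n"
      by (subst q) (simp add: coeff_eq_0 ds)
    then have "\<not> int p dvd lead_coeff s" using Suc ds by simp
    then have IH: "card {x\<in>{0..<int p}. int p dvd poly s x} \<le> n" using Suc.hyps(1)[of s] ds by simp
    have "{x\<in>{0..<int p}. int p dvd poly q x} \<subseteq> insert x0 {x\<in>{0..<int p}. int p dvd poly s x}"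
    proof
      fix x assume "x \<in> {x\<in>{0..<int p}. int p dvd poly q x}"
      then have x: "x \<in> {0..<int p}" "int p dvd poly q x" by auto
      have "poly q x = (x - x0) * poly s x + poly q x0" by (subst q) (simp add: algebra_simps)
      then have "int p dvd (x - x0) * poly s x" using x x0 by (metis dvd_add_left_iff)
      then have "int p dvd x - x0 \<or> int p dvd poly s x"
        using assms(1) prime_dvd_mult_iff[of "int p"] by simp
      moreover have "x = x0" if "int p dvd x - x0"
        using that x(1) x0(1) by (metis atLeastLessThan_iff mod_eq_dvd_iff mod_pos_pos_trivial)
      ultimately show "x \<in> insert x0 {x\<in>{0..<int p}. int p dvd poly s x}" using x by blast
    qed
    then have "card {x\<in>{0..<int p}. int p dvd poly q x} \<le>
        card (insert x0 {x\<in>{0..<int p}. int p dvd poly s x})"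
      by (intro card_mono finite.insertI finite_subset[of "{x\<in>_. _ x}" "{0..<int p}"]) auto
    also have "\<dots> \<le> Suc (card {x\<in>{0..<int p}. int p dvd poly s x})" by (rule card_insert_le_m1) auto
    finally show ?thesis using IH Suc.hyps(2) by linarith
  qed
qed

text \<open>For each residue \<open>y\<close> the polynomial in \<open>x\<close> keeps its leading
  coefficient \<open>c\<close>, a unit modulo \<open>p\<close>, so Lagrange's bound applies on every
  horizontal line.\<close>

lemma card_plane_roots_mod_prime:
  fixes F :: "int poly poly" and p :: nat
  assumes "prime p" "lead_coeff F = [:c:]" "\<not> int p dvd c"
  shows "card {(x,y). x \<in> {0..<int p} \<and> y \<in> {0..<int p} \<and> int p dvd poly_xy F x y} \<le> p * degree F"
proof -
  let ?R = "\<lambda>y. {x\<in>{0..<int p}. int p dvd poly_xy F x y}"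
  have R: "card (?R y) \<le> degree F" for y
  proof -
    let ?q = "map_poly (\<lambda>c. poly c y) F"
    have "c \<noteq> 0" using assms by auto
    have c: "coeff ?q (degree F) = c" using assms by (simp add: coeff_map_poly)
    then have deg: "degree ?q = degree F"
      using \<open>c \<noteq> 0\<close> by (intro antisym degree_le le_degree) (auto simp: coeff_map_poly coeff_eq_0)
    then show ?thesis
      using card_roots_mod_prime[OF assms(1), of ?q] c assms(3) by (simp add: eval_inner)
  qed
  have finR: "finite (?R y)" for y by (rule finite_subset[of _ "{0..<int p}"]) auto
  have "{(x,y). x \<in> {0..<int p} \<and> y \<in> {0..<int p} \<and> int p dvd poly_xy F x y} =
      (\<Union>y\<in>{0..<int p}. (\<lambda>x. (x, y)) ` ?R y)" by auto
  also have "card \<dots> \<le> (\<Sum>y\<in>{0..<int p}. card ((\<lambda>x. (x, y)) ` ?R y))"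
    by (intro card_UN_le) auto
  also have "\<dots> \<le> (\<Sum>y\<in>{0..<int p}. degree F)"
    by (intro sum_mono order_trans[OF card_image_le R] finR)
  also have "\<dots> = p * degree F" by simp
  finally show ?thesis .
qed

section \<open>Integral points on an integral curve\<close>

abbreviation real_bipoly :: "int poly poly \<Rightarrow> real poly poly" where
  "real_bipoly F \<equiv> map_poly (map_poly real_of_int) F"

lemma coeff_real_bipoly [simp]:
  "coeff (coeff (real_bipoly F) i) j = real_of_int (coeff (coeff F i) j)"
  by (simp add: coeff_map_poly)

lemma degree_real_bipoly [simp]: "degree (real_bipoly F) = degree F"
  by (rule degree_map_poly) (auto simp: poly_eq_iff coeff_map_poly)

lemma poly_xy_real_bipoly:
  "poly_xy (real_bipoly F) (of_int x) (of_int y) = of_int (poly_xy F x y)"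
proof -
  have "poly (map_poly real_of_int q) (of_int y) = of_int (poly q y)" for q
    by (induction q) (auto simp: map_poly_pCons)
  then show ?thesis by (induction F) (auto simp: map_poly_pCons)
qed

lemma pderiv_real_bipoly: "pderiv (real_bipoly F) = real_bipoly (pderiv F)"
  by (intro poly_eqI) (simp add: coeff_pderiv coeff_map_poly of_nat_poly)

text \<open>The form of the Bezout bound used for both second curves, the derivative and the
  auxiliary curve: comparing \<open>x\<close>-degrees already shows that \<open>F\<close> does not
  divide \<open>G\<close>.\<close>

lemma card_integer_common_zeros:
  fixes F :: "int poly poly" and G :: "real poly poly" and S :: "(int \<times> int) set"
  assumes F: "irreducible (real_bipoly F)" "degree F = d" "d \<ge> 1" "lead_coeff F = [:c:]"
    and D: "\<And>i. degree (coeff F i) \<le> D" "\<And>i. degree (coeff G i) \<le> D"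
    and G: "G \<noteq> 0" "degree G < d"
    and S: "\<And>x y. (x, y) \<in> S \<Longrightarrow> poly_xy F x y = 0 \<and> poly_xy G (of_int x) (of_int y) = 0"
  shows "card S \<le> (2 * d + 1) * D * d"
proof -
  let ?Z = "{(x,y). poly_xy (real_bipoly F) x y = 0 \<and> poly_xy G x y = 0}"
  have nd: "\<not> real_bipoly F dvd G" using G F dvd_imp_degree_le[of "real_bipoly F" G] by auto
  have deg: "degree (coeff (real_bipoly F) i) \<le> D" for i
    using D(1)[of i] by (intro degree_le) (simp add: coeff_map_poly coeff_eq_0)
  have lc: "degree (lead_coeff (real_bipoly F)) = 0"
    using F(4) by (simp add: coeff_map_poly map_poly_pCons)
  note bez = weak_bezout[OF F(1) _ F(3) nd _ deg D(2) lc]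
  have "inj_on (\<lambda>(x::int,y::int). (real_of_int x, real_of_int y)) S" by (auto simp: inj_on_def)
  then have "card S = card ((\<lambda>(x,y). (real_of_int x, real_of_int y)) ` S)" by (simp add: card_image)
  also have "\<dots> \<le> card ?Z"
    using bez F(2) G(2) S by (intro card_mono) (auto simp: poly_xy_real_bipoly)
  also have "\<dots> \<le> (2 * d + 1) * D * d" using bez F(2) G(2) by simp
  finally show ?thesis .
qed

text \<open>Points with vanishing \<open>x\<close>-derivative are counted by Bezout. Every other
  point is nonsingular modulo some \<open>p \<in> P\<close> by \<open>avoid\<close>; for each such
  \<open>p\<close> there are at most \<open>X * d\<close> classes, and each class is met by its own
  auxiliary curve.\<close>

lemma card_integer_points_bound:
  fixes F :: "int poly poly" and d E M X :: nat and P :: "nat set"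
  assumes F: "irreducible (real_bipoly F)" "degree F = d" "lead_coeff F = [:c:]"
    and dF: "\<And>i. degree (coeff F i) \<le> d"
    and d: "d \<ge> 1" and E: "E \<ge> 1" and M: "M \<ge> 1"
    and P: "finite P" "\<And>p. p \<in> P \<Longrightarrow> prime p" "\<And>p. p \<in> P \<Longrightarrow> p \<le> X"
    and large: "\<And>p. p \<in> P \<Longrightarrow> (real (d * E) + 1)\<^sup>2 * real M ^ (2 * d + E - 1) \<le> real p ^ (d * E - 1)"
    and avoid: "\<And>x y. \<bar>x\<bar> \<le> int M \<Longrightarrow> \<bar>y\<bar> \<le> int M \<Longrightarrow> poly_xy (pderiv F) x y \<noteq> 0 \<Longrightarrow>
       \<exists>p\<in>P. \<not> int p dvd c * poly_xy (pderiv F) x y"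
  shows "card {(x,y). \<bar>x\<bar> \<le> int M \<and> \<bar>y\<bar> \<le> int M \<and> poly_xy F x y = 0} \<le>
      (2 * d + 1) * d * d + card P * (X * d) * ((2 * d + 1) * max d E * d)"
proof -
  define Z where "Z = {(x,y). \<bar>x\<bar> \<le> int M \<and> \<bar>y\<bar> \<le> int M \<and> poly_xy F x y = 0}"
  have finZ: "finite Z" unfolding Z_def
    by (rule finite_subset[of _ "{- int M..int M} \<times> {- int M..int M}"]) auto
  define Z0 where "Z0 = {(x,y)\<in>Z. poly_xy (pderiv F) x y = 0}"
  \<comment> \<open>The factor \<open>c\<close> makes \<open>Cl p\<close> empty for \<open>p\<close>
    dividing \<open>c\<close>, where the count of roots modulo \<open>p\<close> would fail.\<close>
  define Cl where "Cl p = {(x0,y0). x0 \<in> {0..<int p} \<and> y0 \<in> {0..<int p} \<and> int p dvd poly_xy F x0 y0 \<and>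
     \<not> int p dvd c * poly_xy (pderiv F) x0 y0}" for p
  define Zc where "Zc p z = {(x,y)\<in>Z. int p dvd x - fst z \<and> int p dvd y - snd z}" for p z
  have finC: "finite (Cl p)" for p unfolding Cl_def
    by (rule finite_subset[of _ "{0..<int p} \<times> {0..<int p}"]) auto
  have cardZ0: "card Z0 \<le> (2 * d + 1) * d * d"
  proof (rule card_integer_common_zeros[OF F(1,2) d F(3)])
    show "pderiv (real_bipoly F) \<noteq> 0" using F d by (simp add: pderiv_eq_0_iff)
    show "degree (pderiv (real_bipoly F)) < d" using F d by (simp add: degree_pderiv)
    show "degree (coeff F i) \<le> d" for i by (rule dF)
    show "degree (coeff (pderiv (real_bipoly F)) i) \<le> d" for i
      unfolding pderiv_real_bipoly using dF[of "Suc i"]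
      by (intro degree_le) (auto simp: coeff_map_poly coeff_pderiv coeff_eq_0 of_nat_poly)
    show "poly_xy F x y = 0 \<and> poly_xy (pderiv (real_bipoly F)) (of_int x) (of_int y) = 0"
      if "(x, y) \<in> Z0" for x y
      using that by (auto simp: Z0_def Z_def pderiv_real_bipoly poly_xy_real_bipoly)
  qed
  have cardZc: "card (Zc p z) \<le> (2 * d + 1) * max d E * d" if p: "p \<in> P" and z: "z \<in> Cl p" for p z
  proof -
    obtain x0 y0 where [simp]: "z = (x0, y0)" by (cases z)
    have "prime (int p)" using P(2)[OF p] by simp
    moreover have "\<not> int p dvd poly_xy (pderiv F) x0 y0" using z by (auto simp: Cl_def)
    ultimately have cop: "coprime (poly_xy (pderiv F) x0 y0) (int p)"
      by (metis coprime_commute prime_imp_coprime)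
    have p1: "p \<ge> 1" using P(2)[OF p] prime_ge_1_nat by blast
    obtain G :: "real poly poly" where G: "G \<noteq> 0" "degree G < d" "\<And>i. degree (coeff G i) \<le> E"
      "\<And>x y. \<bar>x\<bar> \<le> int M \<Longrightarrow> \<bar>y\<bar> \<le> int M \<Longrightarrow> int p dvd x - x0 \<Longrightarrow> int p dvd y - y0 \<Longrightarrow>
         poly_xy F x y = 0 \<Longrightarrow> poly_xy G (of_int x) (of_int y) = 0"
      using auxiliary_curve[OF cop d E M p1 refl large[OF p]] by blast
    show ?thesis
    proof (rule card_integer_common_zeros[OF F(1,2) d F(3) _ _ G(1,2)])
      show "degree (coeff F i) \<le> max d E" for i using dF[of i] by simp
      show "degree (coeff G i) \<le> max d E" for i using G(3)[of i] by simp
      show "poly_xy F x y = 0 \<and> poly_xy G (of_int x) (of_int y) = 0" if "(x, y) \<in> Zc p z" for x y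
        using that G(4) by (auto simp: Zc_def Z_def)
    qed
  qed
  have cardCl: "card (Cl p) \<le> X * d" if p: "p \<in> P" for p
  proof (cases "int p dvd c")
    case True
    then show ?thesis by (simp add: Cl_def)
  next
    case False
    have "card (Cl p) \<le> card {(x,y). x \<in> {0..<int p} \<and> y \<in> {0..<int p} \<and> int p dvd poly_xy F x y}"
      unfolding Cl_def
      by (intro card_mono finite_subset[of "{(x,y). _ x y}" "{0..<int p} \<times> {0..<int p}"]) auto
    also have "\<dots> \<le> p * d" using card_plane_roots_mod_prime[OF P(2)[OF p] F(3) False] F(2) by simp
    also have "\<dots> \<le> X * d" using P(3)[OF p] by simp
    finally show ?thesis .
  qed
  have "Z \<subseteq> Z0 \<union> (\<Union>p\<in>P. \<Union>z\<in>Cl p. Zc p z)"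
  proof
    fix z assume z: "z \<in> Z"
    obtain x y where [simp]: "z = (x, y)" by (cases z)
    have xy: "\<bar>x\<bar> \<le> int M" "\<bar>y\<bar> \<le> int M" "poly_xy F x y = 0" using z by (auto simp: Z_def)
    show "z \<in> Z0 \<union> (\<Union>p\<in>P. \<Union>z\<in>Cl p. Zc p z)"
    proof (cases "poly_xy (pderiv F) x y = 0")
      case True
      then show ?thesis using z by (simp add: Z0_def)
    next
      case False
      then obtain p where p: "p \<in> P" "\<not> int p dvd c * poly_xy (pderiv F) x y"
        using avoid xy by blast
      have p0: "int p > 0" using P(2)[OF p(1)] by (simp add: prime_gt_0_nat)
      define x0 y0 where "x0 = x mod int p" and "y0 = y mod int p"
      have cong: "int p dvd x0 - x" "int p dvd y0 - y"
        by (simp_all add: x0_def y0_def mod_eq_dvd_iff[symmetric])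
      have "int p dvd poly_xy F x0 y0"
        using poly_xy_dvd_diff[OF cong, of F] xy(3) by simp
      moreover have "\<not> int p dvd c * poly_xy (pderiv F) x0 y0"
      proof
        assume "int p dvd c * poly_xy (pderiv F) x0 y0"
        moreover have "int p dvd c * (poly_xy (pderiv F) x0 y0 - poly_xy (pderiv F) x y)"
          using cong by (intro dvd_mult poly_xy_dvd_diff)
        ultimately have "int p dvd c * poly_xy (pderiv F) x0 y0 -
            c * (poly_xy (pderiv F) x0 y0 - poly_xy (pderiv F) x y)" by (rule dvd_diff)
        then show False using p(2) by (simp add: algebra_simps)
      qed
      ultimately have "(x0, y0) \<in> Cl p" using p0 by (simp add: Cl_def x0_def y0_def)
      moreover have "z \<in> Zc p (x0, y0)"
        using z cong by (auto simp: Zc_def dvd_diff_commute)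
      ultimately show ?thesis using p(1) by blast
    qed
  qed
  moreover have "finite (Z0 \<union> (\<Union>p\<in>P. \<Union>z\<in>Cl p. Zc p z))"
    by (rule finite_subset[OF _ finZ]) (auto simp: Z0_def Zc_def)
  ultimately have "card Z \<le> card (Z0 \<union> (\<Union>p\<in>P. \<Union>z\<in>Cl p. Zc p z))" by (intro card_mono)
  also have "\<dots> \<le> card Z0 + card (\<Union>p\<in>P. \<Union>z\<in>Cl p. Zc p z)" by (rule card_Un_le)
  also have "card (\<Union>p\<in>P. \<Union>z\<in>Cl p. Zc p z) \<le> (\<Sum>p\<in>P. card (\<Union>z\<in>Cl p. Zc p z))"
    by (rule card_UN_le[OF P(1)])
  also have "\<dots> \<le> (\<Sum>p\<in>P. (X * d) * ((2 * d + 1) * max d E * d))"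
  proof (rule sum_mono)
    fix p assume p: "p \<in> P"
    have "card (\<Union>z\<in>Cl p. Zc p z) \<le> (\<Sum>z\<in>Cl p. card (Zc p z))" by (rule card_UN_le[OF finC])
    also have "\<dots> \<le> (\<Sum>z\<in>Cl p. (2 * d + 1) * max d E * d)" using cardZc[OF p] by (rule sum_mono)
    also have "\<dots> \<le> (X * d) * ((2 * d + 1) * max d E * d)"
      using cardCl[OF p] by (simp add: mult_le_mono1)
    finally show "card (\<Union>z\<in>Cl p. Zc p z) \<le> (X * d) * ((2 * d + 1) * max d E * d)" .
  qed
  also have "\<dots> = card P * (X * d) * ((2 * d + 1) * max d E * d)" by simp
  finally show ?thesis using cardZ0 unfolding Z_def by simp
qed

section \<open>A prime from a given set that avoids a given integer\<close>

lemma prod_primes_dvd: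
  fixes z :: int
  assumes "finite P" "\<And>p. p \<in> P \<Longrightarrow> prime p" "\<And>p. p \<in> P \<Longrightarrow> int p dvd z"
  shows "(\<Prod>p\<in>P. int p) dvd z"
  using assms
proof (induction P rule: finite_induct)
  case (insert p P)
  have "coprime (int p) (\<Prod>q\<in>P. int q)"
  proof (rule prod_coprime_right)
    fix q assume "q \<in> P"
    then show "coprime (int p) (int q)" using insert primes_coprime[of p q] by auto
  qed
  then show ?case using insert by (simp add: divides_mult)
qed simp

lemma exists_prime_not_dvd:
  fixes z :: int
  assumes "finite P" "\<And>p. p \<in> P \<Longrightarrow> prime p" "z \<noteq> 0"
    and "\<And>p. p \<in> P \<Longrightarrow> Q \<le> p" "\<bar>z\<bar> < int Q ^ card P"
  shows "\<exists>p\<in>P. \<not> int p dvd z"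
proof (rule ccontr)
  assume "\<not> ?thesis"
  then have "(\<Prod>p\<in>P. int p) dvd z" using assms by (intro prod_primes_dvd) auto
  then have "(\<Prod>p\<in>P. int p) \<le> \<bar>z\<bar>" using assms(3) dvd_imp_le_int[of z "\<Prod>p\<in>P. int p"] by linarith
  moreover have "int Q ^ card P \<le> (\<Prod>p\<in>P. int p)"
    using assms(1,4) prod_mono[of P "\<lambda>_. int Q" int] by simp
  ultimately show False using assms(5) by linarith
qed

lemma abs_poly_xy_le:
  fixes F :: "int poly poly"
  assumes "degree F \<le> d" "\<And>i. degree (coeff F i) \<le> d" "\<And>i j. \<bar>coeff (coeff F i) j\<bar> \<le> A"
    and "\<bar>x\<bar> \<le> M" "\<bar>y\<bar> \<le> M" "M \<ge> 1"
  shows "\<bar>poly_xy F x y\<bar> \<le> (int d + 1)\<^sup>2 * A * M ^ (2 * d)"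
proof -
  have A: "A \<ge> 0" using assms(3)[of 0 0] by simp
  have "\<bar>poly_xy F x y\<bar> \<le> (\<Sum>i\<le>degree F. \<Sum>j\<le>degree (coeff F i). \<bar>coeff (coeff F i) j * x ^ i * y ^ j\<bar>)"
    unfolding poly_xy_altdef by (intro order_trans[OF sum_abs] sum_mono sum_abs)
  also have "\<dots> \<le> (\<Sum>i\<le>degree F. \<Sum>j\<le>degree (coeff F i). A * M ^ (2 * d))"
  proof (intro sum_mono)
    fix i j assume "i \<in> {..degree F}" "j \<in> {..degree (coeff F i)}"
    then have ij: "i \<le> d" "j \<le> d" using assms(1) assms(2)[of i] by auto
    have "\<bar>x\<bar> ^ i * \<bar>y\<bar> ^ j \<le> M ^ i * M ^ j" using assms by (intro mult_mono power_mono) auto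
    also have "\<dots> \<le> M ^ (2 * d)" unfolding power_add[symmetric] using assms ij by (intro power_increasing) auto
    finally have "\<bar>coeff (coeff F i) j\<bar> * (\<bar>x\<bar> ^ i * \<bar>y\<bar> ^ j) \<le> A * M ^ (2 * d)"
      using assms(3) A by (intro mult_mono) auto
    then show "\<bar>coeff (coeff F i) j * x ^ i * y ^ j\<bar> \<le> A * M ^ (2 * d)"
      by (simp add: abs_mult power_abs mult.assoc)
  qed
  also have "\<dots> \<le> (\<Sum>i\<le>degree F. (int d + 1) * (A * M ^ (2 * d)))"
    using assms(2,6) A by (intro sum_mono) (auto intro!: mult_right_mono)
  also have "\<dots> \<le> (int d + 1) * ((int d + 1) * (A * M ^ (2 * d)))"
    using assms(1,6) A by (auto intro!: mult_right_mono)
  finally show ?thesis by (simp add: power2_eq_square mult.assoc)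
qed

section \<open>Reduction to integral polynomials\<close>

text \<open>Comparing \<open>x\<close>-degrees leaves a cofactor \<open>h(y)\<close>. The
  coefficient of \<open>x^d\<close> is constant in both polynomials, as their total degree is at
  most \<open>d\<close>, so \<open>h\<close> is constant too.\<close>

lemma dvd_imp_scalar_multiple:
  fixes F G :: "real poly poly"
  assumes F: "coeff (coeff F d) 0 \<noteq> 0" "total_degree F = d"
    and G: "G \<noteq> 0" "total_degree G \<le> d" and dvd: "F dvd G"
  obtains e where "e \<noteq> 0" "G = [:[:e:]:] * F"
proof -
  have F0: "coeff (coeff F i) j = 0" if "i + j > d" for i j
    using le_total_degree[of F i j] F(2) that by linarith
  have G0: "coeff (coeff G i) j = 0" if "i + j > d" for i j
    using le_total_degree[of G i j] G(2) that by linarith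
  have "coeff F i = 0" if "i > d" for i using that by (intro poly_eqI) (simp add: F0)
  moreover have "coeff F d \<noteq> 0" using F(1) by auto
  ultimately have degF: "degree F = d" by (intro antisym degree_le le_degree) auto
  have degG: "degree G \<le> d" by (rule degree_le) (auto intro!: poly_eqI simp: G0)
  obtain H where H: "G = F * H" using dvd by blast
  have "degree H = 0" using degF degG G(1) unfolding H by (auto simp: degree_mult_eq)
  then obtain h where h: "H = [:h:]" by (metis degree_eq_zeroE)
  obtain a where a: "coeff F d = [:a:]"
    using F0 by (metis degree_eq_zeroE degree_le less_add_same_cancel1 le_zero_eq)
  have "a \<noteq> 0" using a F(1) by auto
  have "coeff G d = smult a h" unfolding H h using a by (simp add: mult.commute)
  moreover have "degree (coeff G d) \<le> 0" by (rule degree_le) (auto simp: G0)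
  ultimately have "degree h = 0" using \<open>a \<noteq> 0\<close> by simp
  then obtain e where "h = [:e:]" by (metis degree_eq_zeroE)
  then show ?thesis using that[of e] G(1) H h by (auto simp: mult.commute)
qed

text \<open>Either the integral points of \<open>F\<close> lie on a second curve of degree \<open>d\<close>, or \<open>F\<close> is up to a
  scalar the integral polynomial with small coefficients that interpolates them.\<close>

lemma integral_model:
  assumes d: "d \<ge> 1"
  shows "\<exists>K. \<forall>(F::real poly poly) (M::nat). M \<ge> 2 \<longrightarrow> irreducible F \<longrightarrow> total_degree F = d \<longrightarrow>
    coeff (coeff F d) 0 \<noteq> 0 \<longrightarrow>
    card {(x::int,y::int). \<bar>x\<bar> \<le> int M \<and> \<bar>y\<bar> \<le> int M \<and> poly_xy F (of_int x) (of_int y) = 0} \<le>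
      (2 * d + 1) * d * d \<or>
    (\<exists>F' c. irreducible (real_bipoly F') \<and> degree F' = d \<and> lead_coeff F' = [:c:] \<and>
       (\<forall>i. degree (coeff F' i) \<le> d) \<and> (\<forall>i j. \<bar>coeff (coeff F' i) j\<bar> \<le> int M ^ K) \<and>
       (\<forall>x y. poly_xy F (of_int x) (of_int y) = 0 \<longleftrightarrow> poly_xy F' x y = 0))"
proof -
  define I where "I = {(i,j). i + j \<le> d}"
  have finI: "finite I" by (rule finite_subset[of _ "{..d} \<times> {..d}"]) (auto simp: I_def)
  have mem: "(i, j) \<in> I \<longleftrightarrow> i + j \<le> d" for i j by (simp add: I_def)
  obtain K where K0: "\<forall>(A::int) (I'::(nat \<times> nat) set) (R::(nat \<times> nat \<Rightarrow> int) set) (v::nat \<times> nat \<Rightarrow> real).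
     2 \<le> A \<longrightarrow> finite I' \<longrightarrow> card I' = card I \<longrightarrow> (\<forall>r\<in>R. \<forall>i\<in>I'. \<bar>r i\<bar> \<le> A) \<longrightarrow>
     (\<exists>i\<in>I'. v i \<noteq> 0) \<longrightarrow> (\<forall>r\<in>R. (\<Sum>i\<in>I'. of_int (r i) * v i) = 0) \<longrightarrow>
     (\<exists>w::nat \<times> nat \<Rightarrow> int. (\<exists>i\<in>I'. w i \<noteq> 0) \<and> (\<forall>i\<in>I'. \<bar>w i\<bar> \<le> A ^ K) \<and>
        (\<forall>r\<in>R. (\<Sum>i\<in>I'. r i * w i) = 0))"
    using small_integer_solution[where 'a = "nat \<times> nat" and n = "card I"] by (rule exE)
  note K = K0[rule_format, OF _ finI refl]
  show ?thesis
  \<comment> \<open>The equations have coefficients of size \<open>M^d\<close>, and the solution is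
    bounded by the \<open>K\<close>-th power of that size.\<close>
  proof (rule exI[of _ "d * K"], intro allI impI)
    fix F :: "real poly poly" and M :: nat
    assume M: "M \<ge> 2" and irr: "irreducible F" and td: "total_degree F = d"
      and top: "coeff (coeff F d) 0 \<noteq> 0"
    define T where "T = {(x::int,y::int). \<bar>x\<bar> \<le> int M \<and> \<bar>y\<bar> \<le> int M \<and>
      poly_xy F (of_int x) (of_int y) = 0}"
    define v where "v = (\<lambda>(i,j). coeff (coeff F i) j)"
    \<comment> \<open>One equation for each integral zero in the box, saying that a polynomial
      vanishes there; the real coefficients \<open>v\<close> of \<open>F\<close> are a nonzero
      solution.\<close>
    define R where "R = (\<lambda>z (i,j). fst z ^ i * snd z ^ j) ` T"
    have R_E: thesis if rR: "r \<in> R" and step: "\<And>x y. (x, y) \<in> T \<Longrightarrow> r = (\<lambda>(i,j). x ^ i * y ^ j) \<Longrightarrow> thesis"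
      for r thesis
    proof -
      obtain z where "z \<in> T" "r = (\<lambda>(i,j). fst z ^ i * snd z ^ j)" using rR unfolding R_def by (rule imageE)
      then show ?thesis using step[of "fst z" "snd z"] by simp
    qed
    have F0: "coeff (coeff F i) j = 0" if "i + j > d" for i j
      using le_total_degree[of F i j] td that by linarith
    have Fv: "F = bipoly I (\<lambda>i j. v (i, j))"
      by (intro poly_eqI) (simp add: coeff_bipoly[OF finI] v_def mem F0)
    have "\<exists>w::nat \<times> nat \<Rightarrow> int. (\<exists>i\<in>I. w i \<noteq> 0) \<and> (\<forall>i\<in>I. \<bar>w i\<bar> \<le> (int M ^ d) ^ K) \<and>
        (\<forall>r\<in>R. (\<Sum>i\<in>I. r i * w i) = 0)"
    proof (rule K[where v = v and A = "int M ^ d" and R = R])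
      have "int M ^ 1 \<le> int M ^ d" using M d by (intro power_increasing) auto
      then show "2 \<le> int M ^ d" using M unfolding power_one_right by linarith
      fix r k assume "r \<in> R" "k \<in> I"
      obtain i j where k: "k = (i, j)" by (cases k)
      obtain x y where xy: "(x, y) \<in> T" "r = (\<lambda>(i,j). x ^ i * y ^ j)"
        using R_E[OF \<open>r \<in> R\<close>] by blast
      have *: "\<bar>x\<bar> \<le> int M" "\<bar>y\<bar> \<le> int M" "i + j \<le> d"
        using xy(1) \<open>k \<in> I\<close> unfolding k mem by (simp_all add: T_def)
      show "\<bar>r k\<bar> \<le> int M ^ d"
      proof -
        have "\<bar>x\<bar> ^ i * \<bar>y\<bar> ^ j \<le> int M ^ i * int M ^ j" using * by (intro mult_mono power_mono) auto
        also have "\<dots> \<le> int M ^ d" unfolding power_add[symmetric] using * M by (intro power_increasing) auto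
        finally show ?thesis by (simp add: k xy(2) abs_mult power_abs)
      qed
    next
      show "\<exists>i\<in>I. v i \<noteq> 0" using top by (intro bexI[of _ "(d, 0)"]) (auto simp: v_def I_def)
      show "(\<Sum>i\<in>I. of_int (r i) * v i) = 0" if rR: "r \<in> R" for r
      proof -
        obtain x y where xy: "(x, y) \<in> T" "r = (\<lambda>(i,j). x ^ i * y ^ j)" using R_E[OF rR] by blast
        have "(\<Sum>i\<in>I. of_int (r i) * v i) = poly_xy F (of_int x) (of_int y)"
          by (subst Fv, unfold poly_xy_bipoly) (auto simp: xy(2) intro!: sum.cong)
        then show ?thesis using xy(1) by (simp add: T_def)
      qed
    qed
    then obtain w where w: "\<exists>i\<in>I. w i \<noteq> 0" "\<And>i. i \<in> I \<Longrightarrow> \<bar>w i\<bar> \<le> int M ^ (d * K)"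
      "\<And>r. r \<in> R \<Longrightarrow> (\<Sum>i\<in>I. r i * w i) = 0" by (auto simp: power_mult)
    define F' where "F' = bipoly I (\<lambda>i j. w (i, j))"
    define G where "G = real_bipoly F'"
    have cF': "coeff (coeff F' i) j = (if i + j \<le> d then w (i, j) else 0)" for i j
      by (simp add: F'_def coeff_bipoly[OF finI] mem)
    have G0: "G \<noteq> 0"
    proof
      assume "G = 0"
      then have z: "real_of_int (coeff (coeff F' i) j) = 0" for i j
        unfolding G_def by (metis coeff_0 coeff_real_bipoly)
      have "w (i, j) = 0" if "i + j \<le> d" for i j using that z[of i j] by (simp add: cF')
      with w(1) show False by (auto simp: mem)
    qed
    have tdG: "total_degree G \<le> d"
      unfolding total_degree_le_iff by (auto simp: G_def cF')
    have degF': "degree F' \<le> d" by (rule degree_le) (auto intro!: poly_eqI simp: cF')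
    have degF'c: "degree (coeff F' i) \<le> d" for i by (rule degree_le) (auto simp: cF')
    have zero: "poly_xy F' x y = 0" if "(x, y) \<in> T" for x y
    proof -
      have "(\<lambda>(i,j). x ^ i * y ^ j) \<in> R" using imageI[OF that, of "\<lambda>z (i,j). fst z ^ i * snd z ^ j"] by (simp add: R_def)
      from w(3)[OF this] show ?thesis unfolding F'_def poly_xy_bipoly
        by (simp add: case_prod_beta mult_ac)
    qed
    have "coeff F i = 0" if "i > d" for i using that by (intro poly_eqI) (simp add: F0)
    moreover have "coeff F d \<noteq> 0" using top by auto
    ultimately have degF: "degree F = d" by (intro antisym degree_le le_degree) auto
    show "card T \<le> (2 * d + 1) * d * d \<or> (\<exists>F' c. irreducible (real_bipoly F') \<and> degree F' = d \<and>
        lead_coeff F' = [:c:] \<and> (\<forall>i. degree (coeff F' i) \<le> d) \<and>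
        (\<forall>i j. \<bar>coeff (coeff F' i) j\<bar> \<le> int M ^ (d * K)) \<and>
        (\<forall>x y. poly_xy F (of_int x) (of_int y) = 0 \<longleftrightarrow> poly_xy F' x y = 0))" (is "?L \<or> ?R")
    proof (cases "F dvd G")
      case False
      have "degree (coeff F i) \<le> d" for i by (rule degree_le) (auto simp: F0)
      moreover have "degree (coeff G i) \<le> d" for i by (rule degree_le) (auto simp: G_def cF')
      moreover have "degree (lead_coeff F) = 0"
        unfolding degF using degree_le[of 0 "coeff F d"] by (simp add: F0)
      ultimately have bez: "finite {(x,y). poly_xy F x y = 0 \<and> poly_xy G x y = 0}"
        "card {(x,y). poly_xy F x y = 0 \<and> poly_xy G x y = 0} \<le> (2 * d + 1) * d * d"
        using weak_bezout[OF irr degF d False, of d] degF' by (simp_all add: G_def)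
      have "inj_on (\<lambda>(x::int,y::int). (real_of_int x, real_of_int y)) T" by (auto simp: inj_on_def)
      then have "card T = card ((\<lambda>(x,y). (real_of_int x, real_of_int y)) ` T)" by (simp add: card_image)
      also have "\<dots> \<le> card {(x,y). poly_xy F x y = 0 \<and> poly_xy G x y = 0}"
        using zero by (intro card_mono bez) (auto simp: T_def G_def poly_xy_real_bipoly)
      finally have ?L using bez(2) by simp
      then show ?thesis ..
    next
      case True
      then obtain e where e: "e \<noteq> 0" "G = [:[:e:]:] * F"
        using dvd_imp_scalar_multiple[OF top td G0 tdG] by blast
      have "[:[:e:]:] dvd 1" using e(1) by (simp add: is_unit_poly_iff dvd_field_iff)
      then have "irreducible G" unfolding e(2) using irr by (simp only: irreducible_mult_unit_left)
      have "coeff (coeff G d) 0 = e * coeff (coeff F d) 0" unfolding e(2) by simp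
      then have "real_of_int (coeff (coeff F' d) 0) \<noteq> 0" using e(1) top by (simp add: G_def)
      then have "coeff F' d \<noteq> 0" by (metis coeff_0 of_int_0)
      then have deg: "degree F' = d" using degF' by (intro antisym le_degree)
      have "degree (coeff F' d) \<le> 0" by (rule degree_le) (auto simp: cF')
      then obtain c where "lead_coeff F' = [:c:]" unfolding deg by (metis degree_eq_zeroE le_zero_eq)
      moreover have "poly_xy F (of_int x) (of_int y) = 0 \<longleftrightarrow> poly_xy F' x y = 0" for x y
      proof -
        have "poly_xy G (of_int x) (of_int y) = e * poly_xy F (of_int x) (of_int y)"
          unfolding e(2) by simp
        then have "real_of_int (poly_xy F' x y) = e * poly_xy F (of_int x) (of_int y)"
          by (simp add: G_def poly_xy_real_bipoly)
        then show ?thesis using e(1) by (metis mult_eq_0_iff of_int_eq_0_iff)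
      qed
      moreover have "\<bar>coeff (coeff F' i) j\<bar> \<le> int M ^ (d * K)" for i j
        using w(2)[of "(i, j)"] by (simp add: cF' mem)
      ultimately have ?R using \<open>irreducible G\<close> deg degF'c unfolding G_def by blast
      then show ?thesis ..
    qed
  qed
qed

section \<open>Choice of the parameters\<close>

text \<open>If too few primes lay between \<open>Q\<close> and \<open>2 * m\<close>, where
  \<open>m = Q * E\<^sup>2\<close>, there would be at most \<open>2 * Q\<close> primes up to
  \<open>2 * m\<close>. Chebyshev's bound then gives \<open>m \<le> 1 + 6 * L * Q\<close>, while
  \<open>m \<ge> L\<^sup>2 * Q\<close> and \<open>L \<ge> 8\<close>. The wide interval costs two
  logarithms only.\<close>

lemma many_primes:
  fixes M Q E R :: nat
  assumes L: "ln (real M) \<ge> 8" and E: "real E \<ge> ln (real M)" and Q: "Q \<ge> 1" and R: "R \<le> Q"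
    and M: "2 * real (Q * E\<^sup>2) \<le> real M ^ 3"
  obtains P where "finite P" "card P = R" "\<And>p. p \<in> P \<Longrightarrow> prime p" "\<And>p. p \<in> P \<Longrightarrow> Q \<le> p"
    "\<And>p. p \<in> P \<Longrightarrow> p \<le> 2 * (Q * E\<^sup>2)"
proof -
  define L where "L = ln (real M)"
  define m where "m = Q * E\<^sup>2"
  define S where "S = {p::nat. prime p \<and> p \<le> 2 * m}"
  define T where "T = {p\<in>S. Q < p}"
  have finS: "finite S" unfolding S_def by (rule finite_subset[of _ "{..2*m}"]) auto
  then have finT: "finite T" by (simp add: T_def)
  have L8: "L \<ge> 8" using L by (simp add: L_def)
  have M1: "real M \<ge> 1" "real M = exp L"
    using L by (cases M; simp add: L_def)+
  have EL: "L\<^sup>2 \<le> (real E)\<^sup>2" using E L8 by (intro power_mono) (auto simp: L_def)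
  have m: "real m \<ge> real Q * L\<^sup>2" unfolding m_def using EL by (simp add: mult_left_mono)
  have "R \<le> card T"
  proof (rule ccontr)
    assume "\<not> R \<le> card T"
    have "S \<subseteq> {1..Q} \<union> T" by (auto simp: S_def T_def dest: prime_ge_1_nat)
    then have "card S \<le> card ({1..Q} \<union> T)" using finT by (intro card_mono) auto
    also have "\<dots> \<le> Q + card T" using card_Un_le[of "{1..Q}" T] by simp
    finally have cS: "card S \<le> 2 * Q" using R \<open>\<not> R \<le> card T\<close> by linarith
    have "E \<ge> 1" using E L by (cases E) auto
    then have "m \<ge> 1" using Q by (simp add: m_def)
    then have "4 ^ m \<le> 2 * (2 * m) ^ card S" unfolding S_def by (rule chebyshev_lower)
    then have "real (4 ^ m) \<le> real (2 * (2 * m) ^ card S)" by (simp only: of_nat_le_iff)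
    then have "4 ^ m \<le> 2 * (2 * real m) ^ card S" by simp
    also have "\<dots> \<le> 2 * (real M ^ 3) ^ card S"
      using M by (intro mult_left_mono power_mono) (auto simp: m_def)
    also have "\<dots> \<le> exp 1 * (real M ^ 3) ^ (2 * Q)"
      using M1(1) cS exp_ge_add_one_self[of 1] by (intro mult_mono power_increasing) (auto simp: one_le_power)
    also have "\<dots> = exp (1 + 6 * (L * real Q))"
      by (simp add: M1(2) exp_add mult_ac flip: exp_of_nat_mult)
    finally have "4 ^ m \<le> exp (1 + 6 * (L * real Q))" .
    moreover have "exp (real m) \<le> 4 ^ m"
    proof -
      have "exp (real m) = exp 1 ^ m" by (simp flip: exp_of_nat_mult)
      also have "\<dots> \<le> 4 ^ m" using exp_le by (intro power_mono) auto
      finally show ?thesis .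
    qed
    ultimately have "exp (real m) \<le> exp (1 + 6 * (L * real Q))" by (rule order_trans[rotated])
    then have "real m \<le> 1 + 6 * (L * real Q)" by simp
    moreover have "8 * (L * real Q) \<le> real m"
    proof -
      have "8 * (L * real Q) \<le> L * (L * real Q)" using L8 by (intro mult_right_mono) auto
      then show ?thesis using m by (simp add: power2_eq_square mult_ac)
    qed
    moreover have "L * real Q \<ge> 8 * 1" using L8 Q by (intro mult_mono) auto
    ultimately show False by linarith
  qed
  then obtain P where P: "P \<subseteq> T" "card P = R" "finite P" using obtain_subset_with_card_n by metis
  have "prime p \<and> Q \<le> p \<and> p \<le> 2 * (Q * E\<^sup>2)" if "p \<in> P" for p
    using subsetD[OF P(1) that] by (simp add: T_def S_def m_def)
  with P show ?thesis using that[of P] by blast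
qed

text \<open>The factor \<open>M^(1/d)\<close> of \<open>p\<close> pays for \<open>M^(E-1)\<close>,
  because \<open>d * (E - 1) \<le> d * E - 1\<close>. The remaining
  \<open>(n + 1)^2 * M^(2d)\<close>, with \<open>n = d * E\<close>, is paid for by the logarithmic
  factor, whose power is at least \<open>L powr L\<close>.\<close>

lemma auxiliary_curve_condition:
  fixes M p d E :: nat
  assumes d: "d \<ge> 2" and L: "L = ln (real M)" "L \<ge> 1" and E: "L \<le> real E" "real E \<le> L + 1"
    and p: "real M powr (1 / real d) * L \<le> real p"
    and large: "(real d * (L + 1) + 1)\<^sup>2 * exp (2 * real d * L) \<le> L powr L"
  shows "(real (d * E) + 1)\<^sup>2 * real M ^ (2 * d + E - 1) \<le> real p ^ (d * E - 1)"
proof -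
  have M: "real M = exp L" "M \<ge> 1" using L by (cases M; simp)+
  have M0: "real M > 0" using M by simp
  have E1: "E \<ge> 1" using E L by (cases E) auto
  have n1: "E \<le> d * E - 1" using mult_le_mono1[OF d, of E] E1 by linarith
  have "(real (d * E) + 1)\<^sup>2 \<le> (real d * (L + 1) + 1)\<^sup>2"
    using E by (intro power_mono) (auto simp: mult_left_mono)
  moreover have "real M ^ (2 * d) = exp (2 * real d * L)"
    unfolding M(1) by (simp flip: exp_of_nat_mult)
  ultimately have "(real (d * E) + 1)\<^sup>2 * real M ^ (2 * d) \<le> L powr L"
    using large by (smt (verit, best) exp_ge_zero mult_right_mono)
  also have "\<dots> \<le> L powr real E" using E L by (intro powr_mono) auto
  also have "\<dots> = L ^ E" using L by (simp add: powr_realpow)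
  also have "\<dots> \<le> L ^ (d * E - 1)" using n1 L by (intro power_increasing) auto
  finally have 1: "(real (d * E) + 1)\<^sup>2 * real M ^ (2 * d) \<le> L ^ (d * E - 1)" .
  have "real M ^ (E - 1) = real M powr real (E - 1)" using M0 by (simp add: powr_realpow)
  also have "\<dots> \<le> real M powr (real (d * E - 1) * (1 / real d))"
  proof (rule powr_mono)
    have "real d * real (E - 1) \<le> real (d * E - 1)"
      using d E1 n1 by (simp add: of_nat_diff algebra_simps)
    then show "real (E - 1) \<le> real (d * E - 1) * (1 / real d)"
      using d by (simp add: field_simps)
  qed (use M L in simp)
  also have "\<dots> = (real M powr (1 / real d)) ^ (d * E - 1)"
    using M0 by (simp add: powr_powr mult.commute flip: powr_realpow)
  finally have 2: "real M ^ (E - 1) \<le> (real M powr (1 / real d)) ^ (d * E - 1)" .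
  have "2 * d + E - 1 = (E - 1) + 2 * d" using E1 by simp
  then have "(real (d * E) + 1)\<^sup>2 * real M ^ (2 * d + E - 1) =
      real M ^ (E - 1) * ((real (d * E) + 1)\<^sup>2 * real M ^ (2 * d))"
    by (simp only: power_add mult_ac)
  also have "\<dots> \<le> (real M powr (1 / real d)) ^ (d * E - 1) * L ^ (d * E - 1)"
    by (intro mult_mono 1 2) auto
  also have "\<dots> = (real M powr (1 / real d) * L) ^ (d * E - 1)" by (simp add: power_mult_distrib)
  also have "\<dots> \<le> real p ^ (d * E - 1)" using p L by (intro power_mono) auto
  finally show ?thesis .
qed

text \<open>With \<open>E\<close> about \<open>L = ln M\<close> and \<open>Q\<close> about
  \<open>M^(1/d) * L\<close>, the count is at most a constant times \<open>Q * E^3\<close>, that is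
  of order \<open>M^(1/d) * L^4\<close>; one further logarithm absorbs the constants. The threshold
  depends on \<open>d\<close> and \<open>K\<close> alone.\<close>

lemma integral_count:
  assumes d: "d \<ge> 2"
  shows "\<exists>M0. \<forall>M\<ge>M0. \<forall>(F::int poly poly) c.
    irreducible (real_bipoly F) \<longrightarrow> degree F = d \<longrightarrow> lead_coeff F = [:c:] \<longrightarrow>
    (\<forall>i. degree (coeff F i) \<le> d) \<longrightarrow> (\<forall>i j. \<bar>coeff (coeff F i) j\<bar> \<le> int M ^ K) \<longrightarrow>
    real (card {(x,y). \<bar>x\<bar> \<le> int M \<and> \<bar>y\<bar> \<le> int M \<and> poly_xy F x y = 0}) \<le>
      real M powr (1 / real d) * ln (real M) ^ 5"
proof -
  \<comment> \<open>\<open>M^k\<close> bounds \<open>c\<close> times the derivative: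
    \<open>c\<close> and the coefficients give \<open>M^(2K)\<close>, the monomials
    \<open>M^(2d)\<close>, and the last \<open>M\<close> absorbs \<open>(d + 1)^3\<close>.\<close>
  define k where "k = 2 * K + 2 * d + 1"
  \<comment> \<open>\<open>R\<close> primes of size at least \<open>M^(1/d)\<close> have product at
    least \<open>M^(k+1)\<close>, so they cannot all divide a nonzero integer bounded by
    \<open>M^k\<close>.\<close>
  define R where "R = d * (k + 1)"
  define C1 where "C1 = (2 * d + 1) * d * d"
  define C2 where "C2 = 2 * R * d * ((2 * d + 1) * d)"
  \<comment> \<open>In order: the condition for the auxiliary curves, the size bound in
    \<open>many_primes\<close>, the absorption of constants together with \<open>d \<le> E\<close>
    and \<open>R \<le> Q\<close>, and the bound on the derivative. The \<open>16\<close> is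
    \<open>2 * 2^3\<close>, from \<open>Q \<le> 2 * q * L\<close> and
    \<open>E \<le> 2 * L\<close>.\<close>
  define good where "good M \<longleftrightarrow>
     (real d * (ln (real M) + 1) + 1)\<^sup>2 * exp (2 * real d * ln (real M)) \<le> ln (real M) powr ln (real M) \<and>
     2 * (real M * ln (real M) + 1) * (ln (real M) + 1)\<^sup>2 \<le> real M ^ 3 \<and>
     real (8 + d + R + C1 + 16 * C2) \<le> ln (real M) \<and> (d + 1) ^ 3 \<le> M" for M :: nat
  have lim: "filterlim (\<lambda>M::nat. ln (real M)) at_top sequentially" by real_asymp
  have "eventually good sequentially"
    unfolding good_def
  proof (intro eventually_conj)
    have "\<forall>\<^sub>F L in at_top. (real d * (L + 1) + 1)\<^sup>2 * exp (2 * real d * L) \<le> L powr L"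
      using d by real_asymp
    from eventually_compose_filterlim[OF this lim]
    show "\<forall>\<^sub>F M in sequentially. (real d * (ln (real M) + 1) + 1)\<^sup>2 * exp (2 * real d * ln (real M)) \<le>
        ln (real M) powr ln (real M)" .
    show "\<forall>\<^sub>F M in sequentially. 2 * (real M * ln (real M) + 1) * (ln (real M) + 1)\<^sup>2 \<le> real M ^ 3"
      by real_asymp
    show "\<forall>\<^sub>F M in sequentially. real (8 + d + R + C1 + 16 * C2) \<le> ln (real M)"
      using lim by (simp only: filterlim_at_top)
  qed (rule eventually_ge_at_top)
  then obtain M0 where M0: "\<And>M. M \<ge> M0 \<Longrightarrow> good M" by (auto simp: eventually_sequentially)
  show ?thesis
  proof (rule exI[of _ M0], intro allI impI)
    fix M :: nat and F :: "int poly poly" and c :: int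
    assume "M \<ge> M0"
    then have good: "good M" by (rule M0)
    assume irr: "irreducible (real_bipoly F)" and deg: "degree F = d" and lc: "lead_coeff F = [:c:]"
      and degc: "\<forall>i. degree (coeff F i) \<le> d" and ht: "\<forall>i j. \<bar>coeff (coeff F i) j\<bar> \<le> int M ^ K"
    define L where "L = ln (real M)"
    have g: "(real d * (L + 1) + 1)\<^sup>2 * exp (2 * real d * L) \<le> L powr L"
      "2 * (real M * L + 1) * (L + 1)\<^sup>2 \<le> real M ^ 3"
      "real (8 + d + R + C1 + 16 * C2) \<le> L" "(d + 1) ^ 3 \<le> M"
      using good by (simp_all only: good_def L_def)
    have L: "L \<ge> 8" "L \<ge> real d" "L \<ge> real R" "L \<ge> real C1 + 16 * real C2" using g(3) by simp_all
    have M2: "M \<ge> 2"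
    proof -
      have "2 \<le> (d + 1) ^ 1" using d by simp
      also have "\<dots> \<le> (d + 1) ^ 3" by (intro power_increasing) auto
      finally show ?thesis using g(4) by simp
    qed
    then have M1: "real M > 1" by simp
    define q where "q = real M powr (1 / real d)"
    have q: "q \<ge> 1" "q \<le> real M"
      using M1 d powr_mono[of "1 / real d" 1 "real M"] by (auto simp: q_def ge_one_powr_ge_zero)
    have "q ^ d = q powr real d" using q by (intro powr_realpow[symmetric]) simp
    also have "\<dots> = real M" using M1 d by (simp add: q_def powr_powr)
    finally have qd: "q ^ d = real M" .
    define E where "E = nat \<lceil>L\<rceil>"
    have E: "L \<le> real E" "real E \<le> L + 1" using L by (auto simp: E_def)
    define Q where "Q = nat \<lceil>q * L\<rceil>"
    have qL: "q * L \<ge> L" using q L by simp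
    have Q: "q * L \<le> real Q" "real Q \<le> q * L + 1" using qL L by (auto simp: Q_def)
    have "q * 1 \<le> q * L" using q L by (intro mult_left_mono) auto
    then have qQ: "q \<le> real Q" using Q(1) by simp
    have Q1: "Q \<ge> 1" using Q qL L by (cases Q) auto
    have RQ: "R \<le> Q" using Q qL L by linarith
    have "2 * real (Q * E\<^sup>2) \<le> 2 * ((real M * L + 1) * (L + 1)\<^sup>2)"
    proof -
      have "real Q \<le> real M * L + 1" using Q q L by (smt (verit) mult_right_mono)
      moreover have "(real E)\<^sup>2 \<le> (L + 1)\<^sup>2" using E by (intro power_mono) auto
      ultimately show ?thesis using L by (auto intro!: mult_mono)
    qed
    then have "2 * real (Q * E\<^sup>2) \<le> real M ^ 3" using g(2) unfolding mult.assoc by (rule order_trans)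
    then obtain P where P: "finite P" "card P = R" "\<And>p. p \<in> P \<Longrightarrow> prime p" "\<And>p. p \<in> P \<Longrightarrow> Q \<le> p"
      "\<And>p. p \<in> P \<Longrightarrow> p \<le> 2 * (Q * E\<^sup>2)"
      using many_primes[of M E Q R] L(1) E(1) Q1 RQ unfolding L_def by metis
    define Z where "Z = {(x,y). \<bar>x\<bar> \<le> int M \<and> \<bar>y\<bar> \<le> int M \<and> poly_xy F x y = 0}"
    have "card Z \<le> (2 * d + 1) * d * d + card P * (2 * (Q * E\<^sup>2) * d) * ((2 * d + 1) * max d E * d)"
      unfolding Z_def
    proof (rule card_integer_points_bound[OF irr deg lc _ _ _ _ P(1) P(3) P(5)])
      show "degree (coeff F i) \<le> d" for i using degc by simp
      show "d \<ge> 1" "M \<ge> 1" using d M2 by auto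
      show "E \<ge> 1" using E L by (cases E) auto
      show "(real (d * E) + 1)\<^sup>2 * real M ^ (2 * d + E - 1) \<le> real p ^ (d * E - 1)" if "p \<in> P" for p
      proof (rule auxiliary_curve_condition[OF d L_def _ E _ g(1)])
        show "real M powr (1 / real d) * L \<le> real p"
          using Q(1) P(4)[OF that] unfolding q_def by linarith
      qed (use L in auto)
      show "\<exists>p\<in>P. \<not> int p dvd c * poly_xy (pderiv F) x y"
        if x: "\<bar>x\<bar> \<le> int M" and y: "\<bar>y\<bar> \<le> int M" and nz: "poly_xy (pderiv F) x y \<noteq> 0" for x y
      proof (rule exists_prime_not_dvd[OF P(1,3) _ P(4)])
        have "c \<noteq> 0" using lc deg d by (metis degree_0 leading_coeff_0_iff not_numeral_le_zero pCons_0_0)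
        then show "c * poly_xy (pderiv F) x y \<noteq> 0" using nz by simp
        have c: "\<bar>c\<bar> \<le> int M ^ K" using ht[rule_format, of d 0] lc deg by simp
        have "\<bar>poly_xy (pderiv F) x y\<bar> \<le> (int d + 1)\<^sup>2 * (int d * int M ^ K) * int M ^ (2 * d)"
        proof (rule abs_poly_xy_le)
          show "degree (pderiv F) \<le> d" using deg by (simp add: degree_pderiv)
          show "degree (coeff (pderiv F) i) \<le> d" for i
            using degc[rule_format, of "Suc i"]
            by (intro degree_le) (auto simp: coeff_pderiv coeff_eq_0 of_nat_poly)
          show "\<bar>coeff (coeff (pderiv F) i) j\<bar> \<le> int d * int M ^ K" for i j
          proof (cases "Suc i \<le> d")
            case True
            have "coeff (coeff (pderiv F) i) j = int (Suc i) * coeff (coeff F (Suc i)) j"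
              by (simp add: coeff_pderiv of_nat_poly)
            moreover have "\<bar>int (Suc i)\<bar> * \<bar>coeff (coeff F (Suc i)) j\<bar> \<le> int d * int M ^ K"
              using True ht by (intro mult_mono) auto
            ultimately show ?thesis by (simp only: abs_mult)
          next
            case False
            then have "coeff F (Suc i) = 0" using deg by (simp add: coeff_eq_0)
            then show ?thesis by (simp add: coeff_pderiv)
          qed
        qed (use x y M2 in auto)
        then have "\<bar>c * poly_xy (pderiv F) x y\<bar> \<le>
            int M ^ K * ((int d + 1)\<^sup>2 * (int d * int M ^ K) * int M ^ (2 * d))"
          unfolding abs_mult using c by (intro mult_mono) auto
        also have "\<dots> \<le> int M ^ K * ((int d + 1)\<^sup>2 * ((int d + 1) * int M ^ K) * int M ^ (2 * d))"
          by (intro mult_left_mono mult_right_mono) auto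
        also have "\<dots> = (int d + 1) ^ 3 * int M ^ (2 * K + 2 * d)"
          by (simp add: power_add power2_eq_square power3_eq_cube mult_2_right mult_ac)
        also have "\<dots> \<le> int M * int M ^ (2 * K + 2 * d)"
        proof (rule mult_right_mono)
          have "int ((d + 1) ^ 3) \<le> int M" using g(4) by (simp only: of_nat_le_iff)
          then show "(int d + 1) ^ 3 \<le> int M" by (simp add: add.commute)
        qed auto
        also have "\<dots> = int M ^ k" by (simp add: k_def)
        finally have z: "\<bar>c * poly_xy (pderiv F) x y\<bar> \<le> int M ^ k" .
        have "real M ^ k < real M ^ (k + 1)" using M1 by (intro power_strict_increasing) auto
        also have "\<dots> = q ^ R"
          unfolding R_def power_mult qd ..
        also have "\<dots> \<le> real Q ^ R" using qQ q by (intro power_mono) auto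
        finally have "real (M ^ k) < real (Q ^ R)" by simp
        then have "int (M ^ k) < int (Q ^ R)" by (simp only: of_nat_less_iff)
        then show "\<bar>c * poly_xy (pderiv F) x y\<bar> < int Q ^ card P" using z P(2) by simp
      qed
    qed
    also have "max d E = E" using E L by simp
    also have "(2 * d + 1) * d * d + card P * (2 * (Q * E\<^sup>2) * d) * ((2 * d + 1) * E * d) = C1 + C2 * (Q * E ^ 3)"
      unfolding P(2) C1_def C2_def by (simp add: algebra_simps power2_eq_square power3_eq_cube)
    finally have "real (card Z) \<le> real (C1 + C2 * (Q * E ^ 3))" by (simp only: of_nat_le_iff)
    also have "\<dots> = real C1 + real C2 * (real Q * real E ^ 3)" by simp
    also have "\<dots> \<le> real C1 * (q * L ^ 4) + real C2 * ((2 * (q * L)) * (2 * L) ^ 3)"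
    proof (intro add_mono mult_left_mono mult_mono power_mono)
      have "1 * 1 \<le> q * L ^ 4" using q L by (intro mult_mono) auto
      then show "real C1 \<le> real C1 * (q * L ^ 4)" using mult_left_mono[of 1 "q * L ^ 4" "real C1"] by simp
      show "real Q \<le> 2 * (q * L)" using Q qL L by linarith
      show "real E \<le> 2 * L" using E L by linarith
    qed (use L q in auto)
    also have "\<dots> = (real C1 + 16 * real C2) * (q * L ^ 4)"
      by (simp add: algebra_simps power_mult_distrib power4_eq_xxxx power3_eq_cube)
    also have "\<dots> \<le> L * (q * L ^ 4)" using L q by (intro mult_right_mono) auto
    also have "\<dots> = q * L ^ 5" by (simp add: mult_ac flip: power_Suc)
    finally show "real (card Z) \<le> real M powr (1 / real d) * ln (real M) ^ 5" by (simp add: q_def L_def)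
  qed
qed


text \<open>In the first alternative of \<open>integral_model\<close> the count is below a constant,
  hence below \<open>ln M\<close>; in the second the zeros are those of the integral model.\<close>

lemma sheared_count:
  assumes d: "d \<ge> 2"
  shows "\<exists>M0. \<forall>M\<ge>M0. \<forall>F::real poly poly.
    irreducible F \<longrightarrow> total_degree F = d \<longrightarrow> coeff (coeff F d) 0 \<noteq> 0 \<longrightarrow>
    real (card {(x::int,y::int). \<bar>x\<bar> \<le> int M \<and> \<bar>y\<bar> \<le> int M \<and> poly_xy F (of_int x) (of_int y) = 0}) \<le>
      real M powr (1 / real d) * ln (real M) ^ 5"
proof -
  define C1 where "C1 = (2 * d + 1) * d * d"
  obtain K where K: "\<And>(F::real poly poly) (M::nat). M \<ge> 2 \<Longrightarrow> irreducible F \<Longrightarrow> total_degree F = d \<Longrightarrow>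
    coeff (coeff F d) 0 \<noteq> 0 \<Longrightarrow>
    card {(x::int,y::int). \<bar>x\<bar> \<le> int M \<and> \<bar>y\<bar> \<le> int M \<and> poly_xy F (of_int x) (of_int y) = 0} \<le> C1 \<or>
    (\<exists>F' c. irreducible (real_bipoly F') \<and> degree F' = d \<and> lead_coeff F' = [:c:] \<and>
       (\<forall>i. degree (coeff F' i) \<le> d) \<and> (\<forall>i j. \<bar>coeff (coeff F' i) j\<bar> \<le> int M ^ K) \<and>
       (\<forall>x y. poly_xy F (of_int x) (of_int y) = 0 \<longleftrightarrow> poly_xy F' x y = 0))"
    using integral_model[of d] d unfolding C1_def by auto
  obtain M0 where M0: "\<And>M (F::int poly poly) c. M \<ge> M0 \<Longrightarrow>
    irreducible (real_bipoly F) \<Longrightarrow> degree F = d \<Longrightarrow> lead_coeff F = [:c:] \<Longrightarrow>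
    (\<forall>i. degree (coeff F i) \<le> d) \<Longrightarrow> (\<forall>i j. \<bar>coeff (coeff F i) j\<bar> \<le> int M ^ K) \<Longrightarrow>
    real (card {(x,y). \<bar>x\<bar> \<le> int M \<and> \<bar>y\<bar> \<le> int M \<and> poly_xy F x y = 0}) \<le>
      real M powr (1 / real d) * ln (real M) ^ 5"
    using integral_count[OF d, of K] by blast
  have "filterlim (\<lambda>M::nat. ln (real M)) at_top sequentially" by real_asymp
  then have "\<forall>\<^sub>F M in sequentially. real (C1 + 1) \<le> ln (real M)" by (simp only: filterlim_at_top)
  then obtain M1 where M1: "\<And>M. M \<ge> M1 \<Longrightarrow> real (C1 + 1) \<le> ln (real M)"
    by (auto simp: eventually_sequentially)
  show ?thesis
  proof (rule exI[of _ "max 2 (max M0 M1)"], intro allI impI)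
    fix M :: nat and F :: "real poly poly"
    assume M: "max 2 (max M0 M1) \<le> M"
      and F: "irreducible F" "total_degree F = d" "coeff (coeff F d) 0 \<noteq> 0"
    let ?Z = "{(x::int,y::int). \<bar>x\<bar> \<le> int M \<and> \<bar>y\<bar> \<le> int M \<and> poly_xy F (of_int x) (of_int y) = 0}"
    have "M \<ge> 2" using M by simp
    from K[OF this F] show "real (card ?Z) \<le> real M powr (1 / real d) * ln (real M) ^ 5"
    proof
      assume "card ?Z \<le> C1"
      then have "real (card ?Z) \<le> 1 * ln (real M) ^ 1" using M1[of M] M by simp
      also have "\<dots> \<le> real M powr (1 / real d) * ln (real M) ^ 5"
        using M M1[of M] by (intro mult_mono power_increasing ge_one_powr_ge_zero) auto
      finally show ?thesis .
    next
      assume "\<exists>F' c. irreducible (real_bipoly F') \<and> degree F' = d \<and> lead_coeff F' = [:c:] \<and>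
       (\<forall>i. degree (coeff F' i) \<le> d) \<and> (\<forall>i j. \<bar>coeff (coeff F' i) j\<bar> \<le> int M ^ K) \<and>
       (\<forall>x y. poly_xy F (of_int x) (of_int y) = 0 \<longleftrightarrow> poly_xy F' x y = 0)"
      then obtain F' c where F': "irreducible (real_bipoly F')" "degree F' = d" "lead_coeff F' = [:c:]"
       "\<forall>i. degree (coeff F' i) \<le> d" "\<forall>i j. \<bar>coeff (coeff F' i) j\<bar> \<le> int M ^ K"
       "\<forall>x y. poly_xy F (of_int x) (of_int y) = 0 \<longleftrightarrow> poly_xy F' x y = 0" by (elim exE conjE)
      have "M0 \<le> M" using M by simp
      from M0[OF this F'(1-5)] show ?thesis using F'(6) by simp
    qed
  qed
qed

theorem theorem1:
  shows "\<exists>C::real. C > 0 \<and>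
    (\<forall>d::nat. d \<ge> 2 \<longrightarrow>
      (\<exists>N0::nat. \<forall>F :: real poly poly. irreducible F \<longrightarrow> total_degree F = d \<longrightarrow>
        (\<forall>N::nat. N \<ge> N0 \<longrightarrow>
          real (card {(x::nat, y::nat). x \<in> {1..N} \<and> y \<in> {1..N} \<and> poly_xy F (real x) (real y) = 0})
            \<le> (ln (real N)) powr (C * real d) * (real N) powr (1 / real d))))"
proof (rule exI[of _ 3], intro conjI allI impI)
  fix d :: nat assume d: "d \<ge> 2"
  obtain M0 where M0: "\<And>M (F::real poly poly). M \<ge> M0 \<Longrightarrow>
    irreducible F \<Longrightarrow> total_degree F = d \<Longrightarrow> coeff (coeff F d) 0 \<noteq> 0 \<Longrightarrow>
    real (card {(x::int,y::int). \<bar>x\<bar> \<le> int M \<and> \<bar>y\<bar> \<le> int M \<and> poly_xy F (of_int x) (of_int y) = 0}) \<le>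
      real M powr (1 / real d) * ln (real M) ^ 5"
    using sheared_count[OF d] by blast
  have "filterlim (\<lambda>N::nat. ln (real N)) at_top sequentially" by real_asymp
  \<comment> \<open>The loss in passing from the box of size \<open>M = (d + 1) * N\<close> to
    \<open>N\<close>: a factor \<open>d + 1\<close> from the power of \<open>M\<close>, and
    \<open>2^5\<close> from \<open>ln M \<le> 2 * ln N\<close>.\<close>
  then have "\<forall>\<^sub>F N in sequentially. real (32 * (d + 1)) \<le> ln (real N)" by (simp only: filterlim_at_top)
  then obtain N1 where N1: "\<And>N. N \<ge> N1 \<Longrightarrow> real (32 * (d + 1)) \<le> ln (real N)"
    by (auto simp: eventually_sequentially)
  show "\<exists>N0::nat. \<forall>F :: real poly poly. irreducible F \<longrightarrow> total_degree F = d \<longrightarrow>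
        (\<forall>N::nat. N \<ge> N0 \<longrightarrow>
          real (card {(x::nat, y::nat). x \<in> {1..N} \<and> y \<in> {1..N} \<and> poly_xy F (real x) (real y) = 0})
            \<le> (ln (real N)) powr (3 * real d) * (real N) powr (1 / real d))"
  proof (rule exI[of _ "max M0 (max N1 (d + 1))"], intro allI impI)
    fix F :: "real poly poly" and N :: nat
    assume F: "irreducible F" "total_degree F = d" and N: "max M0 (max N1 (d + 1)) \<le> N"
    obtain c where c: "c \<le> d" "coeff (coeff (shear (real c) F) d) 0 \<noteq> 0"
      using shear_obtains_monic[OF F(2)] d by auto
    define M where "M = (d + 1) * N"
    define L where "L = ln (real N)"
    have "1 \<le> M" using N by (simp add: M_def)
    then have lnM: "0 \<le> ln (real M)" by simp
    let ?S = "{(x::nat, y::nat). x \<in> {1..N} \<and> y \<in> {1..N} \<and> poly_xy F (real x) (real y) = 0}"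
    let ?Z = "{(x::int,y::int). \<bar>x\<bar> \<le> int M \<and> \<bar>y\<bar> \<le> int M \<and>
      poly_xy (shear (real c) F) (of_int x) (of_int y) = 0}"
    \<comment> \<open>The inverse shear carries zeros of \<open>F\<close> to zeros of the sheared
      polynomial. The second coordinate may be negative, hence integers and a symmetric box;
      \<open>c \<le> d\<close> gives its size.\<close>
    let ?f = "\<lambda>(x::nat,y::nat). (int x, int y - int c * int x)"
    have "inj_on ?f ?S" by (auto simp: inj_on_def)
    then have "card ?S = card (?f ` ?S)" by (simp add: card_image)
    also have "\<dots> \<le> card ?Z"
    proof (rule card_mono)
      show "finite ?Z"
        by (rule finite_subset[of _ "{- int M..int M} \<times> {- int M..int M}"]) auto
      show "?f ` ?S \<subseteq> ?Z"
      proof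
        fix z assume "z \<in> ?f ` ?S"
        then obtain x y where xy: "x \<in> {1..N}" "y \<in> {1..N}" "poly_xy F (real x) (real y) = 0"
          and z: "z = (int x, int y - int c * int x)" by auto
        have "int c * int x \<le> int d * int N" using c xy by (intro mult_mono) auto
        moreover have "int M = int d * int N + int N" by (simp add: M_def algebra_simps)
        moreover have "0 \<le> int c * int x" "0 \<le> int d * int N" "int x \<le> int N" "int y \<le> int N"
          using xy by simp_all
        ultimately have "\<bar>int x\<bar> \<le> int M" "\<bar>int y - int c * int x\<bar> \<le> int M" by linarith+
        then show "z \<in> ?Z" using xy(3) by (simp add: z poly_xy_shear)
      qed
    qed
    finally have "real (card ?S) \<le> real (card ?Z)" by simp
    also have "\<dots> \<le> real M powr (1 / real d) * ln (real M) ^ 5"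
    proof (rule M0)
      show "M0 \<le> M" using N by (simp add: M_def)
    qed (use F c in \<open>simp_all add: irreducible_shear total_degree_shear\<close>)
    also have "\<dots> \<le> (real (d + 1) * real N powr (1 / real d)) * (2 * L) ^ 5"
    proof (intro mult_mono power_mono)
      have "real M powr (1 / real d) = real (d + 1) powr (1 / real d) * real N powr (1 / real d)"
        unfolding M_def of_nat_mult by (rule powr_mult)
      moreover have "real (d + 1) powr (1 / real d) \<le> real (d + 1) powr 1"
        using d by (intro powr_mono) auto
      ultimately show "real M powr (1 / real d) \<le> real (d + 1) * real N powr (1 / real d)"
        by (simp add: mult_right_mono del: of_nat_add of_nat_Suc)
      have "ln (real M) = ln (real (d + 1)) + ln (real N)"
        unfolding M_def of_nat_mult using N by (subst ln_mult) auto
      moreover have "ln (real (d + 1)) \<le> ln (real N)" using N by (subst ln_le_cancel_iff) auto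
      ultimately show "ln (real M) \<le> 2 * L" by (simp add: L_def)
    qed (use lnM in auto)
    also have "\<dots> = real (32 * (d + 1)) * (L ^ 5 * real N powr (1 / real d))"
      by (simp add: power_mult_distrib)
    also have "\<dots> \<le> L * (L ^ 5 * real N powr (1 / real d))"
      using N1[of N] N by (intro mult_right_mono) (auto simp: L_def)
    also have "\<dots> = L powr 6 * real N powr (1 / real d)"
    proof -
      have "L > 0" using N d by (simp add: L_def)
      then have "L powr 6 = L ^ 6" by simp
      also have "\<dots> = L * L ^ 5" by (simp add: eval_nat_numeral)
      finally show ?thesis by (simp add: mult.assoc)
    qed
    \<comment> \<open>As \<open>d \<ge> 2\<close>, the exponent \<open>6\<close> is at most
      \<open>3 * d\<close>; this is the source of \<open>C = 3\<close>.\<close>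
    also have "\<dots> \<le> L powr (3 * real d) * real N powr (1 / real d)"
      using N1[of N] N d by (intro mult_right_mono powr_mono) (auto simp: L_def)
    finally show "real (card ?S) \<le> (ln (real N)) powr (3 * real d) * (real N) powr (1 / real d)"
      by (simp add: L_def)
  qed
qed simp

end
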